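(* Let $X=G/K$ be a compact irreducible Riemannian symmetric space and let $(\mu_t,t\ge0)$ be a convolution semigroup of probability measures on $G$ such that $\mu_t$ is $K$-bi-invariant for all $t\geq 0$ and has a square-integrable density for all $t>0$. Then for all $t>0$ and $x\in X$, $$k_t(x,x)=k_t(o,o)=\mathrm{Tr}(P_t).$$
   Context: $X=G/K$ is a compact (globally Riemannian) symmetric space, with $G$ a compact connected Lie group (the identity component of the isometry group of $X$) and $K$ a closed subgroup, the stabiliser of the point $o=eK$. Irreducible means that $\mathrm{Ad}(K)$ acts irreducibly on $\mathfrak p=\mathfrak g\ominus\mathfrak k$, where $\mathfrak g,\mathfrak k$ are the Lie algebras of $G,K$. Haar measure on $G$ is normalised to mass one; $\sigma$ is the $G$-invariant probability measure on $X$ (image of Haar measure under $\xi(g)=gK$). Densities on $G$ are with respect to normalised Haar measure. A convolution semigroup is a family of probability measures with $\mu_{s+t}=\mu_s*\mu_t$ for all $s,t\ge0$ and $\mu_t\to\mu_0$ weakly as $t\to0$. $K$-bi-invariant means invariant under left and right translations by $K$ (so $\mu_0$ is normalised Haar measure of $K$). $P_tf(g)=\int_Gf(gh)\,\mu_t(dh)$, regarded as an operator on $L^2(G)$, and $\mathrm{Tr}(P_t)$ is its trace there. It is known that a convolution semigroup on a compact group has square-integrable densities for all $t>0$ if and only if it has continuous densities for all $t>0$. $k_t:X\times X\to[0,\infty)$ denotes the continuous transition density with respect to $\sigma$ of the $G$-invariant Feller process on $X$ obtained by projecting under $\xi$ the Lévy process on $G$ with laws $(\mu_t)$; that is, the continuous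 function such that $\int_Xf(y)\,k_t(gK,y)\,\sigma(dy)=\int_Gf(ghK)\,\mu_t(dh)$ for all $f\in C(X)$, $g\in G$. *)

theory Defs
  imports "HOL-Probability.Probability" "HOL-Algebra.Group_Action"
begin

section \<open>Smooth manifolds\<close>

text \<open>Only used for open \<open>S\<close>.\<close>

primrec Ck_on :: "nat \<Rightarrow> ('a::euclidean_space \<Rightarrow> 'b::real_normed_vector) \<Rightarrow> 'a set \<Rightarrow> bool" where
  "Ck_on 0 f S \<longleftrightarrow> continuous_on S f"
| "Ck_on (Suc n) f S \<longleftrightarrow>
     (\<forall>x\<in>S. f differentiable (at x)) \<and> (\<forall>v. Ck_on n (\<lambda>x. frechet_derivative f (at x) v) S)"

definition smooth_on :: "'a::euclidean_space set \<Rightarrow> ('a \<Rightarrow> 'b::real_normed_vector) \<Rightarrow> bool" where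
  "smooth_on S f \<longleftrightarrow> (\<forall>n. Ck_on n f S)"

text \<open>A chart \<open>(U, \<phi>)\<close> consists of its domain and its coordinate map; the values of \<open>\<phi>\<close> outside
  \<open>U\<close> are irrelevant.\<close>

type_synonym ('m, 'e) chart = "'m set \<times> ('m \<Rightarrow> 'e)"

abbreviation chart_inv :: "('m, 'e) chart \<Rightarrow> 'e \<Rightarrow> 'm" where
  "chart_inv c \<equiv> inv_into (fst c) (snd c)"

definition smooth_atlas :: "('m::topological_space, 'e::euclidean_space) chart set \<Rightarrow> bool" where
  "smooth_atlas A \<longleftrightarrow>
     (\<Union>c\<in>A. fst c) = UNIV \<and>
     (\<forall>c\<in>A. open (fst c) \<and> open (snd c ` fst c) \<and>
            homeomorphism (fst c) (snd c ` fst c) (snd c) (chart_inv c)) \<and>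
     (\<forall>c\<in>A. \<forall>d\<in>A. smooth_on (snd c ` (fst c \<inter> fst d)) (snd d \<circ> chart_inv c))"

definition product_atlas ::
  "('m, 'e) chart set \<Rightarrow> ('n, 'f) chart set \<Rightarrow> ('m \<times> 'n, 'e \<times> 'f) chart set" where
  "product_atlas A B = {(fst c \<times> fst d, map_prod (snd c) (snd d)) | c d. c \<in> A \<and> d \<in> B}"

definition smooth_map ::
  "('m::topological_space, 'e::euclidean_space) chart set \<Rightarrow>
   ('n::topological_space, 'f::euclidean_space) chart set \<Rightarrow> ('m \<Rightarrow> 'n) \<Rightarrow> bool" where
  "smooth_map A B f \<longleftrightarrow>
     continuous_on UNIV f \<and>
     (\<forall>c\<in>A. \<forall>d\<in>B. smooth_on (snd c ` (fst c \<inter> f -` fst d)) (snd d \<circ> f \<circ> chart_inv c))"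

text \<open>The tangent space at \<open>p\<close> is represented, in a chart around \<open>p\<close>, by the model space. The next
  constant is the differential of \<open>f\<close> at \<open>p\<close> in the coordinates of \<open>c\<close> (around \<open>p\<close>) and \<open>d\<close>
  (around \<open>f p\<close>); for \<open>f = id\<close> it is the change of tangent coordinates.\<close>

definition coord_deriv ::
  "('m, 'e::euclidean_space) chart \<Rightarrow> ('n, 'f::euclidean_space) chart \<Rightarrow> ('m \<Rightarrow> 'n) \<Rightarrow> 'm \<Rightarrow> 'e \<Rightarrow> 'f" where
  "coord_deriv c d f p = frechet_derivative (snd d \<circ> f \<circ> chart_inv c) (at (snd c p))"

definition inner_form :: "('e::real_vector \<Rightarrow> 'e \<Rightarrow> real) \<Rightarrow> bool" where
  "inner_form q \<longleftrightarrow> bilinear q \<and> (\<forall>u v. q u v = q v u) \<and> (\<forall>u. u \<noteq> 0 \<longrightarrow> q u u > 0)"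


section \<open>Riemannian symmetric spaces\<close>

text \<open>\<open>met c p u v\<close> is the Riemannian metric at \<open>p\<close>, evaluated at the tangent vectors whose
  coordinates in the chart \<open>c\<close> are \<open>u\<close> and \<open>v\<close>.\<close>

locale riemannian_manifold =
  fixes A :: "('x::{t2_space,second_countable_topology}, 'e::euclidean_space) chart set"
    and met :: "('x, 'e) chart \<Rightarrow> 'x \<Rightarrow> 'e \<Rightarrow> 'e \<Rightarrow> real"
  assumes manifold_atlas: "smooth_atlas A"
    and met_inner: "\<And>c p. c \<in> A \<Longrightarrow> p \<in> fst c \<Longrightarrow> inner_form (met c p)"
    and met_smooth: "\<And>c u v. c \<in> A \<Longrightarrow> smooth_on (snd c ` fst c) (\<lambda>z. met c (chart_inv c z) u v)"
    and met_change: "\<And>c d p u v. c \<in> A \<Longrightarrow> d \<in> A \<Longrightarrow> p \<in> fst c \<inter> fst d \<Longrightarrow>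
          met d p (coord_deriv c d id p u) (coord_deriv c d id p v) = met c p u v"
    and connected_space: "connected (UNIV :: 'x set)"
begin

definition isometry :: "('x \<Rightarrow> 'x) \<Rightarrow> bool" where
  "isometry f \<longleftrightarrow>
     bij f \<and> smooth_map A A f \<and> smooth_map A A (inv_into UNIV f) \<and>
     (\<forall>c\<in>A. \<forall>d\<in>A. \<forall>p \<in> fst c \<inter> f -` fst d. \<forall>u v.
        met d (f p) (coord_deriv c d f p u) (coord_deriv c d f p v) = met c p u v)"

text \<open>The isometry group with the compact-open topology.\<close>

definition isometry_topology :: "('x \<Rightarrow> 'x) topology" where
  "isometry_topology = subtopology
     (topology_generated_by {{f. continuous_on UNIV f \<and> f ` C \<subseteq> U} | C U. compact C \<and> open U})
     {f. isometry f}"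

definition identity_component :: "('x \<Rightarrow> 'x) set" where
  "identity_component = connected_component_of_set isometry_topology id"

end

locale riemannian_symmetric_space = riemannian_manifold A met
  for A :: "('x::{t2_space,second_countable_topology}, 'e::euclidean_space) chart set" and met +
  assumes point_symmetry: "\<And>p. \<exists>s. isometry s \<and> s \<circ> s = id \<and> s p = p \<and>
            (\<exists>U. open U \<and> p \<in> U \<and> (\<forall>x\<in>U. s x = x \<longrightarrow> x = p))"

locale lie_group = group G
  for G :: "'g::{t2_space,second_countable_topology} monoid" (structure) +
  fixes B :: "('g, 'a::euclidean_space) chart set"
  assumes carrier_UNIV: "carrier G = UNIV"
    and group_atlas: "smooth_atlas B"
    and smooth_mult: "smooth_map (product_atlas B B) B (\<lambda>(g, h). g \<otimes> h)"
    and smooth_inv: "smooth_map B B (\<lambda>g. inv g)"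
begin

text \<open>In the following \<open>c\<close> is a chart around \<open>\<one>\<close>, through which the Lie algebra of \<open>G\<close>, i.e. the
  tangent space at \<open>\<one>\<close>, is identified with the model space.\<close>

definition Ad :: "('g, 'a) chart \<Rightarrow> 'g \<Rightarrow> 'a \<Rightarrow> 'a" where
  "Ad c k = coord_deriv c c (\<lambda>g. k \<otimes> g \<otimes> inv k) \<one>"

text \<open>The Lie algebra of a closed subgroup \<open>K\<close>: the initial velocities of the one-parameter
  subgroups of \<open>G\<close> that stay in \<open>K\<close>.\<close>

definition subgroup_lie_algebra :: "('g, 'a) chart \<Rightarrow> 'g set \<Rightarrow> 'a set" where
  "subgroup_lie_algebra c K =
     {v. \<exists>\<gamma> :: real \<Rightarrow> 'g. (\<forall>s t. \<gamma> (s + t) = \<gamma> s \<otimes> \<gamma> t) \<and> smooth_map {(UNIV, id)} B \<gamma> \<and>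
           range \<gamma> \<subseteq> K \<and> ((snd c \<circ> \<gamma>) has_vector_derivative v) (at 0)}"

text \<open>The orthogonal complement of the Lie algebra of \<open>K\<close> with respect to an inner product \<open>q\<close>.\<close>

definition lie_complement :: "('g, 'a) chart \<Rightarrow> ('a \<Rightarrow> 'a \<Rightarrow> real) \<Rightarrow> 'g set \<Rightarrow> 'a set" where
  "lie_complement c q K = {v. \<forall>w \<in> subgroup_lie_algebra c K. q v w = 0}"

text \<open>Different charts around \<open>\<one>\<close> and different \<open>Ad(G)\<close>-invariant inner products \<open>q\<close> lead to
  equivalent representations of \<open>K\<close>, so the choice made by the existential quantifier is immaterial.\<close>

definition isotropy_irreducible :: "'g set \<Rightarrow> bool" where
  "isotropy_irreducible K \<longleftrightarrow>
     (\<exists>c\<in>B. \<exists>q. \<one> \<in> fst c \<and> inner_form q \<and> (\<forall>g u v. q (Ad c g u) (Ad c g v) = q u v) \<and>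
        lie_complement c q K \<noteq> {0} \<and>
        (\<forall>W. subspace W \<and> W \<subseteq> lie_complement c q K \<and> (\<forall>k\<in>K. Ad c k ` W \<subseteq> W) \<longrightarrow>
             W = {0} \<or> W = lie_complement c q K))"

end

text \<open>\<open>act\<close> identifies \<open>G\<close>, as a topological group, with the identity component of the isometry
  group of \<open>X\<close> (the whole type \<open>'x\<close>), and \<open>X\<close> is identified with \<open>G/K\<close> through \<open>gK \<mapsto> act g x0\<close>, where
  \<open>K\<close> is the stabiliser of \<open>x0\<close>. The smooth structure of \<open>G\<close> is determined by its topology.\<close>

locale compact_irreducible_symmetric_space =
  lie_group G B + riemannian_symmetric_space A met + transitive_action G UNIV act
  for G :: "'g::{t2_space,second_countable_topology} monoid" (structure)
    and B :: "('g, 'a::euclidean_space) chart set"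
    and A :: "('x::{t2_space,second_countable_topology}, 'e::euclidean_space) chart set"
    and met
    and act :: "'g \<Rightarrow> 'x \<Rightarrow> 'x" +
  fixes x0 :: 'x
  assumes compact_space: "compact (UNIV :: 'x set)"
    and compact_group: "compact (UNIV :: 'g set)"
    and connected_group: "connected (UNIV :: 'g set)"
    and act_homeomorphic:
          "homeomorphic_map euclidean (subtopology isometry_topology identity_component) act"
    and irreducible: "isotropy_irreducible (stabilizer G act x0)"


section \<open>Measures on the group\<close>

definition normalised_haar :: "('g::topological_space) monoid \<Rightarrow> 'g measure \<Rightarrow> bool" where
  "normalised_haar G M \<longleftrightarrow>
     prob_space M \<and> sets M = sets borel \<and> (\<forall>g. distr M borel (\<lambda>h. g \<otimes>\<^bsub>G\<^esub> h) = M)"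

definition group_convolution ::
  "('g::topological_space) monoid \<Rightarrow> 'g measure \<Rightarrow> 'g measure \<Rightarrow> 'g measure" where
  "group_convolution G M N = distr (M \<Otimes>\<^sub>M N) borel (\<lambda>(g, h). g \<otimes>\<^bsub>G\<^esub> h)"

definition convolution_semigroup ::
  "('g::topological_space) monoid \<Rightarrow> (real \<Rightarrow> 'g measure) \<Rightarrow> bool" where
  "convolution_semigroup G \<mu> \<longleftrightarrow>
     (\<forall>t\<ge>0. prob_space (\<mu> t) \<and> sets (\<mu> t) = sets borel) \<and>
     (\<forall>s\<ge>0. \<forall>t\<ge>0. \<mu> (s + t) = group_convolution G (\<mu> s) (\<mu> t)) \<and>
     (\<forall>f :: 'g \<Rightarrow> real. continuous_on UNIV f \<longrightarrow> bounded (range f) \<longrightarrow>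
        ((\<lambda>t. LINT g|\<mu> t. f g) \<longlongrightarrow> (LINT g|\<mu> 0. f g)) (at_right 0))"

definition bi_invariant :: "('g::topological_space) monoid \<Rightarrow> 'g set \<Rightarrow> 'g measure \<Rightarrow> bool" where
  "bi_invariant G K M \<longleftrightarrow>
     (\<forall>k\<in>K. distr M borel (\<lambda>g. k \<otimes>\<^bsub>G\<^esub> g) = M \<and> distr M borel (\<lambda>g. g \<otimes>\<^bsub>G\<^esub> k) = M)"

definition has_square_integrable_density :: "'g measure \<Rightarrow> 'g measure \<Rightarrow> bool" where
  "has_square_integrable_density M N \<longleftrightarrow>
     (\<exists>\<phi> :: 'g \<Rightarrow> real. \<phi> \<in> borel_measurable M \<and> (\<forall>g. 0 \<le> \<phi> g) \<and> integrable M (\<lambda>g. (\<phi> g)\<^sup>2) \<and>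
        N = density M (\<lambda>g. ennreal (\<phi> g)))"

text \<open>\<open>k\<close> is the continuous density, with respect to the image of the Haar measure \<open>M\<close> on \<open>X\<close>, of the
  transition kernel on \<open>X\<close> induced by the measure \<open>N\<close> on \<open>G\<close>.\<close>

definition is_transition_density ::
  "'g monoid \<Rightarrow> 'g measure \<Rightarrow> ('g \<Rightarrow> 'x::topological_space \<Rightarrow> 'x) \<Rightarrow> 'x \<Rightarrow>
   'g measure \<Rightarrow> ('x \<Rightarrow> 'x \<Rightarrow> real) \<Rightarrow> bool" where
  "is_transition_density G M act x0 N k \<longleftrightarrow>
     continuous_on UNIV (\<lambda>(x, y). k x y) \<and> (\<forall>x y. 0 \<le> k x y) \<and>
     (\<forall>f :: 'x \<Rightarrow> real. continuous_on UNIV f \<longrightarrow>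
        (\<forall>g. (LINT y|distr M borel (\<lambda>h. act h x0). f y * k (act g x0) y) =
             (LINT h|N. f (act (g \<otimes>\<^bsub>G\<^esub> h) x0))))"

definition convolution_operator ::
  "'g monoid \<Rightarrow> 'g measure \<Rightarrow> ('g \<Rightarrow> complex) \<Rightarrow> 'g \<Rightarrow> complex" where
  "convolution_operator G N f g = (LINT h|N. f (g \<otimes>\<^bsub>G\<^esub> h))"


section \<open>Traces of operators on \<open>L\<^sup>2\<close>\<close>

text \<open>Elements of \<open>L\<^sup>2(M)\<close> are represented by square-integrable functions, so that equations between
  them hold almost everywhere.\<close>

definition l2_space :: "'a measure \<Rightarrow> ('a \<Rightarrow> complex) set" where
  "l2_space M = {f \<in> borel_measurable M. integrable M (\<lambda>x. (cmod (f x))\<^sup>2)}"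

definition l2_inner :: "'a measure \<Rightarrow> ('a \<Rightarrow> complex) \<Rightarrow> ('a \<Rightarrow> complex) \<Rightarrow> complex" where
  "l2_inner M f g = (LINT x|M. f x * cnj (g x))"

definition l2_orthonormal_basis :: "'a measure \<Rightarrow> ('a \<Rightarrow> complex) set \<Rightarrow> bool" where
  "l2_orthonormal_basis M E \<longleftrightarrow>
     E \<subseteq> l2_space M \<and> (\<forall>e\<in>E. \<forall>f\<in>E. l2_inner M e f = (if e = f then 1 else 0)) \<and>
     (\<forall>f\<in>l2_space M. (\<forall>e\<in>E. l2_inner M f e = 0) \<longrightarrow> (AE x in M. f x = 0))"

definition l2_bounded_operator :: "'a measure \<Rightarrow> (('a \<Rightarrow> complex) \<Rightarrow> 'a \<Rightarrow> complex) \<Rightarrow> bool" where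
  "l2_bounded_operator M T \<longleftrightarrow>
     (\<forall>f\<in>l2_space M. T f \<in> l2_space M) \<and>
     (\<forall>f\<in>l2_space M. \<forall>g\<in>l2_space M. \<forall>a b.
        AE x in M. T (\<lambda>x. a * f x + b * g x) x = a * T f x + b * T g x) \<and>
     (\<exists>C. \<forall>f\<in>l2_space M. (LINT x|M. (cmod (T f x))\<^sup>2) \<le> C * (LINT x|M. (cmod (f x))\<^sup>2))"

text \<open>A bounded operator is of trace class iff the sum of its diagonal entries converges
  unconditionally (in the sense of \<open>has_sum\<close>) for every orthonormal basis; the sum is then
  independent of the basis. So the following says that \<open>T\<close> is of trace class with trace \<open>\<tau>\<close>.\<close>

definition has_l2_trace ::
  "'a measure \<Rightarrow> (('a \<Rightarrow> complex) \<Rightarrow> 'a \<Rightarrow> complex) \<Rightarrow> complex \<Rightarrow> bool" where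
  "has_l2_trace M T \<tau> \<longleftrightarrow>
     l2_bounded_operator M T \<and>
     (\<forall>E. l2_orthonormal_basis M E \<longrightarrow> ((\<lambda>e. l2_inner M (T e) e) has_sum \<tau>) E)"

end

theory Submission
  imports Defs
begin

text \<open>Write \<open>\<psi>\<^sub>t h = k\<^sub>t(o, h o)\<close>. Bi-invariance under \<open>K\<close> forces \<open>\<mu>\<^sub>t\<close> to have the continuous density
  \<open>\<psi>\<^sub>t\<close>, and uniqueness of continuous densities gives \<open>k\<^sub>t(g o, h o) = \<psi>\<^sub>t(g\<^sup>-\<^sup>1 h)\<close>, so \<open>k\<^sub>t\<close> is constant on
  the diagonal. With \<open>\<phi> = \<psi>\<close> at time \<open>t/2\<close>, the semigroup law reads \<open>\<psi>\<^sub>t = \<phi> * \<phi>\<close>, and \<open>P\<^sub>t\<close> is the square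
  of the integral operator with continuous kernel \<open>\<phi>(g\<^sup>-\<^sup>1 h)\<close>. By Parseval its trace over any orthonormal
  basis is \<open>\<integral>\<integral> \<phi>(g\<^sup>-\<^sup>1 h) \<phi>(h\<^sup>-\<^sup>1 g) dg dh = \<integral> \<phi>(h) \<phi>(h\<^sup>-\<^sup>1) dh = \<psi>\<^sub>t(e)\<close>.\<close>

section \<open>Square-integrable functions\<close>

text \<open>The law \<open>\<mu> t\<close> need not be invariant under inversion, so the operator
  \<open>P\<^sub>t\<close> need be neither self-adjoint nor positive, and Mercer's theorem does not
  yield its trace. A product of two Hilbert-Schmidt operators is of trace class whatever their
  symmetry; this is why the time is halved, and the trace becomes the pairing of one kernel with the
  transpose of the other. The trace is claimed for every orthonormal basis, given as a bare set of
  functions whose completeness only means a trivial orthogonal complement. Convergence of the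
  expansions is therefore derived, along finite subsets, since the sum is meant unconditionally. The
  claim concerns the value of a density at one point, where an almost-everywhere identity says
  nothing. Hence densities are kept continuous and compared through the full support of Haar
  measure.\<close>

abbreviation l2_sq :: "'a measure \<Rightarrow> ('a \<Rightarrow> complex) \<Rightarrow> real" where
  "l2_sq M f \<equiv> LINT x|M. (cmod (f x))\<^sup>2"

lemma l2_spaceD:
  assumes "f \<in> l2_space M"
  shows "f \<in> borel_measurable M" "integrable M (\<lambda>x. (cmod (f x))\<^sup>2)"
  using assms by (auto simp: l2_space_def)

lemma l2_mult_integrable:
  assumes f: "f \<in> l2_space M" and g: "g \<in> l2_space M"
  shows "integrable M (\<lambda>x. f x * g x)"
proof (rule Bochner_Integration.integrable_bound)
  show "integrable M (\<lambda>x. (cmod (f x))\<^sup>2 + (cmod (g x))\<^sup>2)"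
    using l2_spaceD[OF f] l2_spaceD[OF g] by simp
  show "(\<lambda>x. f x * g x) \<in> borel_measurable M"
    using l2_spaceD[OF f] l2_spaceD[OF g] by simp
  have "cmod (f x * g x) \<le> (cmod (f x))\<^sup>2 + (cmod (g x))\<^sup>2" for x
    using sum_squares_bound[of "cmod (f x)" "cmod (g x)"]
      mult_nonneg_nonneg[OF norm_ge_zero[of "f x"] norm_ge_zero[of "g x"]]
    unfolding norm_mult mult.assoc by linarith
  then show "AE x in M. norm (f x * g x) \<le> norm ((cmod (f x))\<^sup>2 + (cmod (g x))\<^sup>2)"
    by (smt (verit) AE_I2 real_norm_def)
qed

lemma l2_space_cnj [simp]: "(\<lambda>x. cnj (f x)) \<in> l2_space M \<longleftrightarrow> f \<in> l2_space M"
proof -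
  have "(\<lambda>x. cnj (f x)) \<in> borel_measurable M \<longleftrightarrow> f \<in> borel_measurable M" for f :: "'a \<Rightarrow> complex"
    using borel_measurable_continuous_onI[OF continuous_on_cnj[OF continuous_on_id]]
      measurable_compose[of _ M borel cnj borel]
    by (metis (no_types, lifting) complex_cnj_cnj measurable_cong)
  then show ?thesis by (auto simp: l2_space_def)
qed

lemma l2_inner_integrable:
  "f \<in> l2_space M \<Longrightarrow> g \<in> l2_space M \<Longrightarrow> integrable M (\<lambda>x. f x * cnj (g x))"
  by (intro l2_mult_integrable) simp_all

lemma l2_space_scale: "f \<in> l2_space M \<Longrightarrow> (\<lambda>x. c * f x) \<in> l2_space M"
  by (auto simp: l2_space_def norm_mult power_mult_distrib)

lemma l2_space_add:
  assumes f: "f \<in> l2_space M" and g: "g \<in> l2_space M"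
  shows "(\<lambda>x. f x + g x) \<in> l2_space M"
proof -
  have "integrable M (\<lambda>x. (cmod (f x + g x))\<^sup>2)"
  proof (rule Bochner_Integration.integrable_bound)
    show "integrable M (\<lambda>x. 2 * (cmod (f x))\<^sup>2 + 2 * (cmod (g x))\<^sup>2)"
      using l2_spaceD[OF f] l2_spaceD[OF g] by simp
    show "(\<lambda>x. (cmod (f x + g x))\<^sup>2) \<in> borel_measurable M"
      using l2_spaceD[OF f] l2_spaceD[OF g] by simp
    have "(cmod (f x + g x))\<^sup>2 \<le> 2 * (cmod (f x))\<^sup>2 + 2 * (cmod (g x))\<^sup>2" for x
    proof -
      have "(cmod (f x + g x))\<^sup>2 \<le> (cmod (f x) + cmod (g x))\<^sup>2"
        by (intro power_mono norm_triangle_ineq) simp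
      also have "\<dots> \<le> 2 * (cmod (f x))\<^sup>2 + 2 * (cmod (g x))\<^sup>2"
        using sum_squares_bound[of "cmod (f x)" "cmod (g x)"] by (simp add: power2_sum)
      finally show ?thesis .
    qed
    then show "AE x in M. norm ((cmod (f x + g x))\<^sup>2) \<le> norm (2 * (cmod (f x))\<^sup>2 + 2 * (cmod (g x))\<^sup>2)"
      by simp
  qed
  then show ?thesis using l2_spaceD[OF f] l2_spaceD[OF g] by (simp add: l2_space_def)
qed

lemma l2_space_diff:
  assumes "f \<in> l2_space M" "g \<in> l2_space M"
  shows "(\<lambda>x. f x - g x) \<in> l2_space M"
  using l2_space_add[OF assms(1) l2_space_scale[OF assms(2), of "- 1"]] by simp

lemma l2_space_sum:
  assumes "\<And>e. e \<in> F \<Longrightarrow> f e \<in> l2_space M"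
  shows "(\<lambda>x. \<Sum>e\<in>F. f e x) \<in> l2_space M"
  using assms
proof (induction F rule: infinite_finite_induct)
  case (insert e F)
  then show ?case using l2_space_add[of "f e" M "\<lambda>x. \<Sum>e\<in>F. f e x"] by simp
\<comment> \<open>Over an infinite index set \<open>sum\<close> defaults to 0, so membership holds
  there too.\<close>
qed (simp_all add: l2_space_def)

lemma l2_inner_diff_left:
  assumes "f \<in> l2_space M" "g \<in> l2_space M" "h \<in> l2_space M"
  shows "l2_inner M (\<lambda>x. f x - g x) h = l2_inner M f h - l2_inner M g h"
  using assms by (simp add: l2_inner_def left_diff_distrib l2_inner_integrable)

lemma l2_inner_scale_left: "l2_inner M (\<lambda>x. c * f x) g = c * l2_inner M f g"
  by (simp add: l2_inner_def mult.assoc)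

lemma l2_inner_sum_left:
  assumes "\<And>e. e \<in> F \<Longrightarrow> f e \<in> l2_space M" "g \<in> l2_space M"
  shows "l2_inner M (\<lambda>x. \<Sum>e\<in>F. f e x) g = (\<Sum>e\<in>F. l2_inner M (f e) g)"
  using assms by (simp add: l2_inner_def sum_distrib_right l2_inner_integrable)

lemma l2_inner_commute: "l2_inner M g f = cnj (l2_inner M f g)"
proof -
  have "cnj (l2_inner M f g) = (LINT x|M. cnj (f x * cnj (g x)))"
    unfolding l2_inner_def by (rule integral_bounded_linear'[OF bounded_linear_cnj bounded_linear_cnj, symmetric]) simp
  then show ?thesis
    by (simp add: l2_inner_def mult.commute del: integral_cnj)
qed

lemma l2_inner_self: "l2_inner M f f = complex_of_real (l2_sq M f)"
  unfolding l2_inner_def integral_complex_of_real[symmetric]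
  by (simp only: complex_norm_square)

text \<open>The discriminant argument is run on the moduli of the two functions, so the quadratic in
  \<open>s\<close> is real and no phase has to be chosen.\<close>

lemma l2_cauchy_schwarz:
  assumes f: "f \<in> l2_space M" and g: "g \<in> l2_space M"
  shows "(cmod (l2_inner M f g))\<^sup>2 \<le> l2_sq M f * l2_sq M g"
proof -
  define a b c where "a = l2_sq M f" "b = l2_sq M g" "c = (LINT x|M. cmod (f x) * cmod (g x))"
  have int: "integrable M (\<lambda>x. cmod (f x) * cmod (g x))"
    using integrable_norm[OF l2_mult_integrable[OF f g]] by (simp add: norm_mult)
  have "0 \<le> s\<^sup>2 * a - 2 * s * c + b" for s
  proof -
    have "0 \<le> (LINT x|M. (s * cmod (f x) - cmod (g x))\<^sup>2)"
      by simp
    also have "\<dots> = (LINT x|M. s\<^sup>2 * (cmod (f x))\<^sup>2 - 2 * s * (cmod (f x) * cmod (g x)) + (cmod (g x))\<^sup>2)"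
      by (intro Bochner_Integration.integral_cong) (auto simp: power2_eq_square algebra_simps)
    also have "\<dots> = s\<^sup>2 * a - 2 * s * c + b"
      using int l2_spaceD[OF f] l2_spaceD[OF g] by (simp add: a_b_c_def)
    finally show ?thesis .
  qed
  note quad = this
  have "a \<ge> 0" "b \<ge> 0" "c \<ge> 0" by (auto simp: a_b_c_def)
  have "c\<^sup>2 \<le> a * b"
  proof (cases "a = 0")
    case True
    have "c = 0"
    proof (rule ccontr)
      assume "c \<noteq> 0"
      \<comment> \<open>With \<open>a = 0\<close> the quadratic is \<open>b - 2 * s * c\<close>;
        this choice of \<open>s\<close> gives it the negative value \<open>- b - 2\<close>.\<close>
      then show False using quad[of "(b + 1) / c"] True \<open>b \<ge> 0\<close> by simp
    qed
    then show ?thesis by (simp add: True)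
  next
    case False
    then have "a > 0" using \<open>a \<ge> 0\<close> by simp
    \<comment> \<open>\<open>c / a\<close> is the minimiser of the quadratic.\<close>
    then show ?thesis using quad[of "c / a"] by (simp add: field_simps power2_eq_square)
  qed
  moreover have "cmod (l2_inner M f g) \<le> c"
    using integral_norm_bound[of M "\<lambda>x. f x * cnj (g x)"] by (simp add: l2_inner_def a_b_c_def norm_mult)
  then have "(cmod (l2_inner M f g))\<^sup>2 \<le> c\<^sup>2" by (intro power_mono) auto
  ultimately show ?thesis unfolding a_b_c_def by linarith
qed

lemma (in prob_space) l2_space_integrable:
  "f \<in> l2_space M \<Longrightarrow> integrable M f"
  using l2_mult_integrable[of f M "\<lambda>_. 1"] by (simp add: l2_space_def)

lemma (in prob_space) expectation_cmod_sq_le: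
  assumes "f \<in> l2_space M"
  shows "(LINT x|M. cmod (f x))\<^sup>2 \<le> l2_sq M f"
proof -
  have f: "(\<lambda>x. complex_of_real (cmod (f x))) \<in> l2_space M" and 1: "(\<lambda>_. 1) \<in> l2_space M"
    using assms by (auto simp: l2_space_def)
  show ?thesis using l2_cauchy_schwarz[OF f 1]
    by (simp add: l2_inner_def prob_space)
qed

section \<open>Orthonormal expansions: Bessel's inequality and completeness\<close>

definition l2_projection ::
  "'a measure \<Rightarrow> ('a \<Rightarrow> complex) set \<Rightarrow> ('a \<Rightarrow> complex) \<Rightarrow> 'a \<Rightarrow> complex" where
  "l2_projection M F f = (\<lambda>x. \<Sum>e\<in>F. l2_inner M f e * e x)"

lemma l2_orthonormal_basisD:
  assumes "l2_orthonormal_basis M E"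
  shows "E \<subseteq> l2_space M" "e \<in> E \<Longrightarrow> e \<in> l2_space M"
    "e \<in> E \<Longrightarrow> e' \<in> E \<Longrightarrow> l2_inner M e e' = (if e = e' then 1 else 0)"
  using assms by (auto simp: l2_orthonormal_basis_def)

lemma l2_projection_in_l2_space:
  assumes "l2_orthonormal_basis M E" "F \<subseteq> E"
  shows "l2_projection M F f \<in> l2_space M"
  unfolding l2_projection_def using assms
  by (intro l2_space_sum l2_space_scale) (auto dest: l2_orthonormal_basisD)

lemma l2_combination_terms:
  assumes E: "l2_orthonormal_basis M E" and F: "F \<subseteq> E" and d: "d \<in> F"
  shows "(\<lambda>x. c * d x) \<in> l2_space M"
  using assms by (intro l2_space_scale l2_orthonormal_basisD(2)[OF E]) auto

lemma l2_inner_combination: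
  assumes E: "l2_orthonormal_basis M E" and F: "finite F" "F \<subseteq> E" and e: "e \<in> E"
  shows "l2_inner M (\<lambda>x. \<Sum>d\<in>F. c d * d x) e = (if e \<in> F then c e else 0)"
proof -
  have "l2_inner M (\<lambda>x. \<Sum>d\<in>F. c d * d x) e = (\<Sum>d\<in>F. c d * l2_inner M d e)"
    using E F e by (subst l2_inner_sum_left)
      (auto intro: l2_combination_terms[OF E F(2)] l2_orthonormal_basisD(2)[OF E] simp: l2_inner_scale_left)
  also have "\<dots> = (\<Sum>d\<in>F. if d = e then c d else 0)"
    using F e l2_orthonormal_basisD(3)[OF E] by (intro sum.cong) auto
  finally show ?thesis using F by simp
qed

lemma l2_sq_combination:
  assumes E: "l2_orthonormal_basis M E" and F: "finite F" "F \<subseteq> E"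
  shows "l2_sq M (\<lambda>x. \<Sum>d\<in>F. c d * d x) = (\<Sum>d\<in>F. (cmod (c d))\<^sup>2)"
proof -
  let ?s = "\<lambda>x. \<Sum>d\<in>F. c d * d x"
  have s: "?s \<in> l2_space M"
    using E F by (intro l2_space_sum l2_space_scale) (auto dest: l2_orthonormal_basisD)
  have "l2_inner M ?s ?s = (\<Sum>d\<in>F. c d * cnj (l2_inner M ?s d))"
    using E F s by (subst l2_inner_sum_left)
      (auto intro!: l2_combination_terms[OF E F(2)] sum.cong
        simp: l2_inner_scale_left l2_inner_commute[symmetric])
  also have "\<dots> = (\<Sum>d\<in>F. c d * cnj (c d))"
    using F by (intro sum.cong refl) (simp add: l2_inner_combination[OF E F] subset_iff)
  also have "\<dots> = complex_of_real (\<Sum>d\<in>F. (cmod (c d))\<^sup>2)"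
    by (simp add: complex_norm_square del: of_real_power)
  finally show ?thesis unfolding l2_inner_self of_real_eq_iff .
qed

text \<open>Pythagoras. The exact value matters later, not only its sign: it writes the residual in
  terms of the norm of \<open>f\<close> and finitely many inner products, hence as a continuous
  function when \<open>f\<close> depends suitably on a parameter.\<close>

lemma l2_sq_residual:
  assumes E: "l2_orthonormal_basis M E" and F: "finite F" "F \<subseteq> E" and f: "f \<in> l2_space M"
  shows "l2_sq M (\<lambda>x. f x - l2_projection M F f x) = l2_sq M f - (\<Sum>e\<in>F. (cmod (l2_inner M f e))\<^sup>2)"
proof -
  let ?p = "l2_projection M F f"
  note p = l2_projection_in_l2_space[OF E F(2), of f]
  have pp: "l2_inner M ?p ?p = complex_of_real (\<Sum>e\<in>F. (cmod (l2_inner M f e))\<^sup>2)"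
    unfolding l2_inner_self using l2_sq_combination[OF E F] by (simp add: l2_projection_def)
  have pf: "l2_inner M ?p f = complex_of_real (\<Sum>e\<in>F. (cmod (l2_inner M f e))\<^sup>2)"
  proof -
    have "l2_inner M ?p f = (\<Sum>e\<in>F. l2_inner M f e * cnj (l2_inner M f e))"
      unfolding l2_projection_def using E F f
      by (subst l2_inner_sum_left)
        (auto intro!: l2_combination_terms[OF E F(2)] sum.cong
          simp: l2_inner_scale_left l2_inner_commute[symmetric])
    then show ?thesis by (simp add: complex_norm_square del: of_real_power)
  qed
  have fp: "l2_inner M f ?p = l2_inner M ?p f"
    by (subst l2_inner_commute) (simp add: pf)
  have "l2_inner M (\<lambda>x. f x - ?p x) (\<lambda>x. f x - ?p x)
      = l2_inner M f (\<lambda>x. f x - ?p x) - l2_inner M ?p (\<lambda>x. f x - ?p x)"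
    by (rule l2_inner_diff_left) (intro f p l2_space_diff)+
  \<comment> \<open>The residual is orthogonal to the projection, because <f,p> and <p,p> are the
    same real number; so the second inner product vanishes.\<close>
  also have "\<dots> = l2_inner M f f - l2_inner M ?p f"
    using l2_inner_diff_left[OF f p f] l2_inner_diff_left[OF f p p]
    by (subst (1 2) l2_inner_commute) (simp add: pf fp pp del: of_real_sum of_real_power,
      simp add: l2_inner_commute[symmetric] fp pf)
  also have "\<dots> = complex_of_real (l2_sq M f - (\<Sum>e\<in>F. (cmod (l2_inner M f e))\<^sup>2))"
    by (simp only: pf l2_inner_self of_real_diff)
  finally show ?thesis unfolding l2_inner_self of_real_eq_iff .
qed

lemma l2_bessel:
  fixes M :: "'a measure"
  assumes "l2_orthonormal_basis M E" "finite F" "F \<subseteq> E" "f \<in> l2_space M"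
  shows "(\<Sum>e\<in>F. (cmod (l2_inner M f e))\<^sup>2) \<le> l2_sq M f"
proof -
  have "0 \<le> l2_sq M (\<lambda>x. f x - l2_projection M F f x)" by simp
  then show ?thesis unfolding l2_sq_residual[OF assms] by simp
qed

text \<open>The rate \<open>(1/4) ^ n\<close> for squared norms bounds the mean of each increment by
  \<open>(1/2) ^ n\<close>, because the total mass is one. These means are summable, so the
  increments are absolutely summable almost everywhere.\<close>

lemma (in prob_space) l2_riesz_fischer:
  assumes s: "\<And>n. s n \<in> l2_space M"
    and le: "\<And>m n. n \<le> m \<Longrightarrow> l2_sq M (\<lambda>x. s m x - s n x) \<le> (1/4) ^ n"
  shows "\<exists>f\<in>l2_space M. \<forall>n. l2_sq M (\<lambda>x. f x - s n x) \<le> (1/4) ^ n"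
proof -
  have [measurable]: "s n \<in> borel_measurable M" for n using s by (rule l2_spaceD)
  define d where "d n x = cmod (s (Suc n) x - s n x)" for n x
  have [measurable]: "d n \<in> borel_measurable M" for n unfolding d_def by measurable
  have d_nonneg: "d n x \<ge> 0" for n x by (simp add: d_def)
  have diff: "(\<lambda>x. s m x - s n x) \<in> l2_space M" for m n by (intro l2_space_diff s)
  have int_d: "integrable M (d n)" for n
    unfolding d_def by (intro integrable_norm l2_space_integrable diff)
  have d_le: "(LINT x|M. d n x) \<le> (1/2) ^ n" for n
  proof (rule power2_le_imp_le)
    have "(LINT x|M. d n x)\<^sup>2 \<le> l2_sq M (\<lambda>x. s (Suc n) x - s n x)"
      unfolding d_def by (rule expectation_cmod_sq_le[OF diff])
    also have "\<dots> \<le> ((1/2) ^ n)\<^sup>2"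
      using le[of n "Suc n"] by (simp add: power_divide power2_eq_square flip: power_mult_distrib)
    finally show "(LINT x|M. d n x)\<^sup>2 \<le> ((1/2) ^ n)\<^sup>2" .
  qed simp
  have "(\<integral>\<^sup>+x. (\<Sum>n. ennreal (d n x)) \<partial>M) = (\<Sum>n. \<integral>\<^sup>+x. ennreal (d n x) \<partial>M)"
    by (rule nn_integral_suminf) simp
  also have "\<dots> = (\<Sum>n. ennreal (LINT x|M. d n x))"
    by (intro suminf_cong nn_integral_eq_integral) (simp_all add: int_d d_nonneg)
  also have "\<dots> \<le> (\<Sum>n. ennreal ((1/2) ^ n))"
    by (intro suminf_le ennreal_leI d_le) auto
  also have "\<dots> = ennreal (\<Sum>n. (1/2) ^ n)"
    by (intro suminf_ennreal2) (auto intro: summable_geometric)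
  finally have "(\<integral>\<^sup>+x. (\<Sum>n. ennreal (d n x)) \<partial>M) \<noteq> \<infinity>"
    by (auto simp: top_unique)
  then have "AE x in M. (\<Sum>n. ennreal (d n x)) \<noteq> \<infinity>"
    by (intro nn_integral_PInf_AE) auto
  then have conv: "AE x in M. (\<lambda>n. s n x) \<longlonglongrightarrow> lim (\<lambda>n. s n x)"
  proof eventually_elim
    case (elim x)
    then have "summable (\<lambda>n. d n x)"
      by (intro summable_suminf_not_top) (auto simp: d_def)
    then have "summable (\<lambda>n. s (Suc n) x - s n x)"
      unfolding d_def by (rule summable_norm_cancel)
    then have "convergent (\<lambda>n. \<Sum>i<n. s (Suc i) x - s i x)"
      by (simp add: summable_iff_convergent)
    then have "convergent (\<lambda>n. s n x - s 0 x)"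
      unfolding sum_lessThan_telescope[of "\<lambda>i. s i x"] .
    then have "convergent (\<lambda>n. s n x)"
      by (simp add: convergent_diff_const_right_iff)
    then show ?case by (simp add: convergent_LIMSEQ_iff)
  qed
  define f where "f x = lim (\<lambda>n. s n x)" for x
  have f[measurable]: "f \<in> borel_measurable M"
    unfolding f_def by (rule borel_measurable_lim_metric) simp
  \<comment> \<open>Fatou's lemma in \<open>m\<close> carries the Cauchy estimate over to the limit;
    finiteness of the bound also makes the difference square-integrable.\<close>
  have fatou: "(\<integral>\<^sup>+x. ennreal ((cmod (f x - s n x))\<^sup>2) \<partial>M) \<le> ennreal ((1/4) ^ n)" for n
  proof -
    have "(\<integral>\<^sup>+x. ennreal ((cmod (f x - s n x))\<^sup>2) \<partial>M)
        = (\<integral>\<^sup>+x. liminf (\<lambda>m. ennreal ((cmod (s m x - s n x))\<^sup>2)) \<partial>M)"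
    proof (rule nn_integral_cong_AE, use conv in eventually_elim)
      case (elim x)
      then have "(\<lambda>m. ennreal ((cmod (s m x - s n x))\<^sup>2)) \<longlonglongrightarrow> ennreal ((cmod (f x - s n x))\<^sup>2)"
        unfolding f_def by (intro tendsto_intros)
      then show ?case by (rule lim_imp_Liminf[OF trivial_limit_sequentially, symmetric])
    qed
    also have "\<dots> \<le> liminf (\<lambda>m. \<integral>\<^sup>+x. ennreal ((cmod (s m x - s n x))\<^sup>2) \<partial>M)"
      by (rule nn_integral_liminf) simp
    also have "\<dots> \<le> ennreal ((1/4) ^ n)"
    proof (rule Liminf_le)
      show "\<forall>\<^sub>F m in sequentially. (\<integral>\<^sup>+x. ennreal ((cmod (s m x - s n x))\<^sup>2) \<partial>M) \<le> ennreal ((1/4) ^ n)"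
        using eventually_ge_at_top[of n]
      proof eventually_elim
        case (elim m)
        then show ?case
          using le[OF elim] l2_spaceD(2)[OF diff[of m n]]
          by (simp add: nn_integral_eq_integral ennreal_leI)
      qed
    qed simp
    finally show ?thesis .
  qed
  have f_diff: "(\<lambda>x. f x - s n x) \<in> l2_space M" for n
  proof -
    have "integrable M (\<lambda>x. (cmod (f x - s n x))\<^sup>2)"
      using le_less_trans[OF fatou[of n]] by (intro integrableI_bounded) auto
    then show ?thesis by (simp add: l2_space_def)
  qed
  show ?thesis
  proof (intro bexI allI)
    show "f \<in> l2_space M" using l2_space_add[OF f_diff[of 0] s[of 0]] by simp
    fix n
    show "l2_sq M (\<lambda>x. f x - s n x) \<le> (1/4) ^ n"
      using fatou[of n] l2_spaceD(2)[OF f_diff[of n]]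
      by (subst (asm) nn_integral_eq_integral) (auto simp: ennreal_le_iff2 intro: order_trans)
  qed
qed

text \<open>Coefficient sums over finite sets are bounded by Bessel. Sets that nearly attain their
  supremum give a Cauchy sequence of projections, and its limit \<open>g\<close> has the same
  coefficients as \<open>f\<close>; the trivial orthogonal complement then forces
  \<open>f = g\<close> almost everywhere. The cardinality of \<open>E\<close> never enters.\<close>

lemma (in prob_space) l2_orthonormal_basis_complete:
  assumes E: "l2_orthonormal_basis M E" and f: "f \<in> l2_space M" and \<epsilon>: "\<epsilon> > 0"
  obtains F where "finite F" "F \<subseteq> E" "l2_sq M (\<lambda>x. f x - l2_projection M F f x) < \<epsilon>"
proof -
  define c where "c F = (\<Sum>e\<in>F. (cmod (l2_inner M f e))\<^sup>2)" for F
  define S where "S = {c F | F. finite F \<and> F \<subseteq> E}"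
  have bdd: "bdd_above S"
    unfolding S_def c_def using l2_bessel[OF E _ _ f] by (intro bdd_aboveI[of _ "l2_sq M f"]) auto
  have ne: "S \<noteq> {}" unfolding S_def by auto
  \<comment> \<open>The margins \<open>(1/4) ^ n\<close> are those demanded by
    \<open>l2_riesz_fischer\<close>.\<close>
  have "\<forall>n::nat. \<exists>F. finite F \<and> F \<subseteq> E \<and> Sup S - (1/4) ^ n < c F"
  proof
    fix n :: nat
    have "\<exists>y\<in>S. Sup S - (1/4) ^ n < y"
      using less_cSup_iff[OF ne bdd, of "Sup S - (1/4) ^ n"] by simp
    then show "\<exists>F. finite F \<and> F \<subseteq> E \<and> Sup S - (1/4) ^ n < c F"
      unfolding S_def by blast
  qed
  then obtain H where "\<forall>n. finite (H n) \<and> H n \<subseteq> E \<and> Sup S - (1/4) ^ n < c (H n)"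
    by atomize_elim (rule choice)
  then have H: "finite (H n)" "H n \<subseteq> E" "Sup S - (1/4) ^ n < c (H n)" for n by blast+
  \<comment> \<open>Accumulating the sets makes them nested, so two projections differ by an
    orthonormal combination over \<open>F m - F n\<close>.\<close>
  define F where "F n = (\<Union>i\<le>n. H i)" for n :: nat
  have F: "finite (F n)" "F n \<subseteq> E" for n using H unfolding F_def by auto
  have F_mono: "F n \<subseteq> F m" if "n \<le> m" for n m using that unfolding F_def by fastforce
  have c_mono: "c A \<le> c B" if "A \<subseteq> B" "finite B" for A B
    unfolding c_def using that by (intro sum_mono2) auto
  have c_F: "Sup S - (1/4) ^ n < c (F n)" for n
    using H(3)[of n] c_mono[of "H n" "F n"] F(1)[of n] unfolding F_def by force
  have c_le: "c A \<le> Sup S" if "finite A" "A \<subseteq> E" for A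
    using that by (intro cSup_upper bdd) (auto simp: S_def)
  define s where "s n = l2_projection M (F n) f" for n
  have s: "s n \<in> l2_space M" for n unfolding s_def by (rule l2_projection_in_l2_space[OF E F(2)])
  have "l2_sq M (\<lambda>x. s m x - s n x) \<le> (1/4) ^ n" if "n \<le> m" for m n
  proof -
    have "s m x - s n x = (\<Sum>e\<in>F m - F n. l2_inner M f e * e x)" for x
      unfolding s_def l2_projection_def using F_mono[OF that] F(1)[of m] by (simp add: sum_diff)
    then have "l2_sq M (\<lambda>x. s m x - s n x) = c (F m - F n)"
      using F by (simp add: c_def) (intro l2_sq_combination[OF E], auto)
    also have "\<dots> = c (F m) - c (F n)"
      unfolding c_def using F_mono[OF that] F by (intro sum_diff) auto
    also have "\<dots> \<le> (1/4) ^ n" using c_F[of n] c_le[OF F, of m] by linarith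
    finally show ?thesis .
  qed
  note step = this
  obtain g where "g \<in> l2_space M" "\<forall>n. l2_sq M (\<lambda>x. g x - s n x) \<le> (1/4) ^ n"
    using l2_riesz_fischer[of s, OF s step] by blast
  then have g: "g \<in> l2_space M" "l2_sq M (\<lambda>x. g x - s n x) \<le> (1/4) ^ n" for n by auto
  have quarter: "((1/2) ^ n)\<^sup>2 = (1/4 :: real) ^ n" for n
    by (simp add: power2_eq_square flip: power_mult_distrib)
  have inner0: "l2_inner M (\<lambda>x. f x - g x) e = 0" if e: "e \<in> E" for e
  proof -
    have e': "e \<in> l2_space M" "l2_sq M e = 1"
      using l2_orthonormal_basisD(2)[OF E e] l2_orthonormal_basisD(3)[OF E e e]
      by (auto simp: l2_inner_self)
    have "cmod (l2_inner M (\<lambda>x. f x - g x) e) \<le> 2 * (1/2) ^ n" for n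
    proof -
      have "l2_inner M (\<lambda>x. f x - g x) e = l2_inner M f e - l2_inner M g e"
        by (intro l2_inner_diff_left f g e')
      also have "\<dots> = (l2_inner M f e - l2_inner M (s n) e) - l2_inner M (\<lambda>x. g x - s n x) e"
        by (subst l2_inner_diff_left) (auto intro: g s e')
      finally have eq: "l2_inner M (\<lambda>x. f x - g x) e
          = (l2_inner M f e - l2_inner M (s n) e) - l2_inner M (\<lambda>x. g x - s n x) e" .
      have "(cmod (l2_inner M (\<lambda>x. g x - s n x) e))\<^sup>2 \<le> ((1/2) ^ n)\<^sup>2"
        using l2_cauchy_schwarz[OF l2_space_diff[OF g(1) s[of n]] e'(1)] g(2)[of n]
        unfolding e'(2) quarter by simp
      then have 1: "cmod (l2_inner M (\<lambda>x. g x - s n x) e) \<le> (1/2) ^ n"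
        by (rule power2_le_imp_le) simp
      have se: "l2_inner M (s n) e = (if e \<in> F n then l2_inner M f e else 0)"
        unfolding s_def l2_projection_def by (rule l2_inner_combination[OF E F e])
      have 2: "cmod (l2_inner M f e - l2_inner M (s n) e) \<le> (1/2) ^ n"
      proof (cases "e \<in> F n")
        case False
        \<comment> \<open>Adjoining \<open>e\<close> adds its squared coefficient to a sum already
          within \<open>(1/4) ^ n\<close> of the supremum, so that coefficient is small.\<close>
        have "c (insert e (F n)) = (cmod (l2_inner M f e))\<^sup>2 + c (F n)"
          unfolding c_def using False F by simp
        moreover have "c (insert e (F n)) \<le> Sup S" using F e by (intro c_le) auto
        ultimately have "(cmod (l2_inner M f e))\<^sup>2 \<le> ((1/2) ^ n)\<^sup>2"
          using c_F[of n] unfolding quarter by linarith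
        then have "cmod (l2_inner M f e) \<le> (1/2) ^ n" by (rule power2_le_imp_le) simp
        then show ?thesis using False by (simp add: se)
      qed (simp add: se)
      show ?thesis unfolding eq by (rule order_trans[OF norm_triangle_ineq4]) (use 1 2 in linarith)
    qed
    then have le: "\<exists>N. \<forall>n\<ge>N. cmod (l2_inner M (\<lambda>x. f x - g x) e) \<le> 2 * (1/2) ^ n" by blast
    have "(\<lambda>n. 2 * (1/2) ^ n :: real) \<longlonglongrightarrow> 2 * 0"
      by (intro tendsto_intros LIMSEQ_power_zero) simp
    from LIMSEQ_le_const[OF this le] have "cmod (l2_inner M (\<lambda>x. f x - g x) e) \<le> 0" by simp
    then show ?thesis by simp
  qed
  then have fg: "AE x in M. f x - g x = 0"
    using E l2_space_diff[OF f g(1)] unfolding l2_orthonormal_basis_def by blast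
  obtain n where n: "(1/4) ^ n < \<epsilon>" using real_arch_pow_inv[OF \<epsilon>, of "1/4"] by auto
  have "l2_sq M (\<lambda>x. f x - l2_projection M (F n) f x) = l2_sq M (\<lambda>x. g x - s n x)"
    using l2_spaceD(1)[OF f] l2_spaceD(1)[OF g(1)] l2_spaceD(1)[OF s[of n]] fg
    by (intro integral_cong_AE) (auto simp: s_def)
  also have "\<dots> < \<epsilon>" using g(2)[of n] n by simp
  finally show thesis using that F by blast
qed

section \<open>Traces of products of integral operators\<close>

text \<open>In a first-countable space continuity can be tested on sequences, where dominated
  convergence applies.\<close>

lemma continuous_on_integral_dominated:
  fixes p :: "'a::first_countable_topology \<Rightarrow> 'b \<Rightarrow> 'c::{banach, second_countable_topology}"
  assumes meas: "\<And>z. p z \<in> borel_measurable M"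
    and cont: "\<And>h. continuous_on UNIV (\<lambda>z. p z h)"
    and w: "integrable M w" "\<And>z h. norm (p z h) \<le> w h"
  shows "continuous_on UNIV (\<lambda>z. LINT h|M. p z h)"
  unfolding continuous_on_def
proof
  fix z
  show "((\<lambda>z. LINT h|M. p z h) \<longlongrightarrow> (LINT h|M. p z h)) (at z)"
    unfolding tendsto_at_iff_sequentially
  proof (intro allI impI)
    fix X assume X: "X \<longlonglongrightarrow> z"
    have "(\<lambda>i. LINT h|M. p (X i) h) \<longlonglongrightarrow> (LINT h|M. p z h)"
    proof (rule integral_dominated_convergence[where w = w])
      show "AE h in M. (\<lambda>i. p (X i) h) \<longlonglongrightarrow> p z h"
        using continuous_on_tendsto_compose[OF cont X] by simp
    qed (use meas w in auto)
    then show "((\<lambda>z. LINT h|M. p z h) \<circ> X) \<longlonglongrightarrow> (LINT h|M. p z h)"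
      by (simp add: comp_def)
  qed
qed

lemma compact_UNIV_norm_bound:
  fixes f :: "'a::topological_space \<Rightarrow> 'b::real_normed_vector"
  assumes "compact (UNIV :: 'a set)" "continuous_on UNIV f"
  obtains C where "C > 0" "\<And>x. norm (f x) \<le> C"
  using compact_imp_bounded[OF compact_continuous_image[OF assms(2,1)]]
  by (auto simp: bounded_pos)

lemma compact_UNIV_prod:
  assumes "compact (UNIV :: 'a::topological_space set)" "compact (UNIV :: 'b::topological_space set)"
  shows "compact (UNIV :: ('a \<times> 'b) set)"
  using compact_Times[OF assms] by simp

lemma continuous_on_curried:
  assumes "continuous_on UNIV (\<lambda>(x, y). f x y)"
  shows "continuous_on UNIV (f x)" "continuous_on UNIV (\<lambda>x. f x y)"
proof -
  have "continuous_on UNIV (\<lambda>y. (x, y))" "continuous_on UNIV (\<lambda>x. (x, y))"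
    by (intro continuous_intros)+
  from this[THEN continuous_on_compose2[OF assms]]
  show "continuous_on UNIV (f x)" "continuous_on UNIV (\<lambda>x. f x y)" by simp_all
qed

lemma integrable_continuous_compact:
  fixes f :: "'a::topological_space \<Rightarrow> 'b::{banach, second_countable_topology}"
  assumes "prob_space M" "sets M = sets borel" "compact (UNIV :: 'a set)" "continuous_on UNIV f"
  shows "integrable M f"
proof -
  interpret prob_space M by fact
  obtain C where "\<And>x. norm (f x) \<le> C"
    using compact_UNIV_norm_bound[OF assms(3,4)] by blast
  moreover have "f \<in> borel_measurable M"
    using borel_measurable_continuous_onI[OF assms(4)] measurable_cong_sets[OF assms(2) refl] by blast
  ultimately show ?thesis by (intro integrable_const_bound[of _ C]) auto
qed

text \<open>The residuals of Bessel's inequality for the functions \<open>P z\<close> are continuous in \<open>z\<close> and decrease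
  to \<open>0\<close> along the finite subsets of \<open>E\<close>, so by Dini's argument they do so uniformly; this lets sum
  and integral be exchanged without countability of \<open>E\<close>.\<close>

lemma l2_kernel_trace:
  fixes M :: "'a::second_countable_topology measure" and P Q :: "'a \<Rightarrow> 'a \<Rightarrow> complex"
  assumes M: "prob_space M" "sets M = sets borel" and cpt: "compact (UNIV :: 'a set)"
    and P: "continuous_on UNIV (\<lambda>(z, h). P z h)" and Q: "continuous_on UNIV (\<lambda>(z, h). Q z h)"
    and E: "l2_orthonormal_basis M E"
  shows "((\<lambda>e. LINT z|M. l2_inner M (P z) e * cnj (l2_inner M (Q z) e)) has_sum
    (LINT z|M. l2_inner M (P z) (Q z))) E"
proof -
  interpret prob_space M by fact
  have cptp: "compact (UNIV :: ('a \<times> 'a) set)" by (rule compact_UNIV_prod[OF cpt cpt])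
  obtain A where A: "A > 0" "\<And>x. norm (case x of (z, h) \<Rightarrow> P z h) \<le> A"
    using compact_UNIV_norm_bound[OF cptp P] by metis
  obtain C where C: "C > 0" "\<And>x. norm (case x of (z, h) \<Rightarrow> Q z h) \<le> C"
    using compact_UNIV_norm_bound[OF cptp Q] by metis
  have PA: "cmod (P z h) \<le> A" for z h using A(2)[of "(z, h)"] by simp
  have QC: "cmod (Q z h) \<le> C" for z h using C(2)[of "(z, h)"] by simp
  note contP = continuous_on_curried[OF P] and contQ = continuous_on_curried[OF Q]
  have meas: "f \<in> borel_measurable M" if "continuous_on UNIV f" for f :: "'a \<Rightarrow> complex"
    using borel_measurable_continuous_onI[OF that] measurable_cong_sets[OF M(2) refl] by blast
  have l2: "f \<in> l2_space M" if "continuous_on UNIV f" for f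
  proof -
    have "continuous_on UNIV (\<lambda>x. (cmod (f x))\<^sup>2)" by (intro continuous_intros that)
    then show ?thesis
      using integrable_continuous_compact[OF M cpt] meas[OF that] by (simp add: l2_space_def)
  qed
  have Pl2: "P z \<in> l2_space M" and Ql2: "Q z \<in> l2_space M" for z
    by (intro l2 contP contQ)+
  have inner_cont: "continuous_on UNIV (\<lambda>z. l2_inner M (K z) g)"
    if K: "\<And>z h. cmod (K z h) \<le> B" "\<And>z. continuous_on UNIV (K z)"
      "\<And>h. continuous_on UNIV (\<lambda>z. K z h)" and g: "g \<in> l2_space M" for K :: "'a \<Rightarrow> 'a \<Rightarrow> complex" and B g
    unfolding l2_inner_def
  proof (rule continuous_on_integral_dominated)
    show "integrable M (\<lambda>h. B * cmod (g h))"
      using l2_space_integrable[OF g] by simp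
    show "norm (K z h * cnj (g h)) \<le> B * cmod (g h)" for z h
      using K(1) by (auto simp: norm_mult intro: mult_right_mono)
    show "(\<lambda>h. K z h * cnj (g h)) \<in> borel_measurable M" for z
      using meas[OF K(2)] l2_spaceD(1)[of "\<lambda>h. cnj (g h)"] g by simp
  qed (intro continuous_intros K)
  have P_cont: "continuous_on UNIV (\<lambda>z. l2_inner M (P z) g)" if "g \<in> l2_space M" for g
    using inner_cont[of P A] PA contP that by blast
  have Q_cont: "continuous_on UNIV (\<lambda>z. l2_inner M (Q z) g)" if "g \<in> l2_space M" for g
    using inner_cont[of Q C] QC contQ that by blast
  have Psq_cont: "continuous_on UNIV (\<lambda>z. l2_sq M (P z))"
  proof (rule continuous_on_integral_dominated)
    show "integrable M (\<lambda>h. A\<^sup>2)" by simp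
    show "norm ((cmod (P z h))\<^sup>2) \<le> A\<^sup>2" for z h
      using PA by (simp add: power_mono)
    show "(\<lambda>h. (cmod (P z h))\<^sup>2) \<in> borel_measurable M" for z
      using meas[OF contP(1)] by simp
  qed (intro continuous_intros contP)
  have Qsq: "l2_sq M (Q z) \<le> C\<^sup>2" for z
  proof -
    have "l2_sq M (Q z) \<le> (LINT h|M. C\<^sup>2)"
      using QC by (intro integral_mono l2_spaceD(2)[OF Ql2]) (auto intro: power_mono)
    then show ?thesis by (simp add: prob_space)
  qed
  have El2: "e \<in> l2_space M" if "e \<in> E" for e using l2_orthonormal_basisD(2)[OF E that] .
  define r where "r F z = l2_sq M (P z) - (\<Sum>e\<in>F. (cmod (l2_inner M (P z) e))\<^sup>2)" for F z
  have r_eq: "l2_sq M (\<lambda>x. P z x - l2_projection M F (P z) x) = r F z" if "finite F" "F \<subseteq> E" for F z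
    unfolding r_def by (rule l2_sq_residual[OF E that Pl2])
  have r_mono: "r F' z \<le> r F z" if "F \<subseteq> F'" "finite F'" for F F' z
    unfolding r_def using that by (auto intro: sum_mono2)
  have dini: "\<exists>F. finite F \<and> F \<subseteq> E \<and> (\<forall>z. r F z < \<delta>)" if \<delta>: "\<delta> > 0" for \<delta>
  proof -
    define U where "U F = {z. r F z < \<delta>}" for F
    have "open (U F)" if "F \<in> {F. finite F \<and> F \<subseteq> E}" for F
      unfolding U_def r_def using that
      by (intro open_Collect_less continuous_intros Psq_cont P_cont El2) auto
    moreover have "UNIV \<subseteq> (\<Union>F\<in>{F. finite F \<and> F \<subseteq> E}. U F)"
    proof
      fix z
      obtain F where "finite F" "F \<subseteq> E" "l2_sq M (\<lambda>x. P z x - l2_projection M F (P z) x) < \<delta>"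
        using l2_orthonormal_basis_complete[OF E Pl2 \<delta>] by metis
      then show "z \<in> (\<Union>F\<in>{F. finite F \<and> F \<subseteq> E}. U F)"
        unfolding U_def using r_eq by auto
    qed
    ultimately obtain \<F> where \<F>: "\<F> \<subseteq> {F. finite F \<and> F \<subseteq> E}" "finite \<F>" "UNIV \<subseteq> (\<Union>F\<in>\<F>. U F)"
      by (rule compactE_image[OF cpt])
    \<comment> \<open>The residual decreases as the index set grows, so the union of the finitely
      many covering sets serves every \<open>z\<close> at once.\<close>
    have "r (\<Union>\<F>) z < \<delta>" for z
    proof -
      obtain F where F: "F \<in> \<F>" "r F z < \<delta>" using \<F>(3) unfolding U_def by blast
      have "r (\<Union>\<F>) z \<le> r F z" using F \<F> by (intro r_mono) auto
      then show ?thesis using F by simp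
    qed
    then show ?thesis using \<F> by (intro exI[of _ "\<Union>\<F>"]) auto
  qed
  show ?thesis unfolding has_sum_def
  proof (rule tendstoI)
    fix \<epsilon> :: real assume \<epsilon>: "\<epsilon> > 0"
    \<comment> \<open>By Cauchy-Schwarz the error at \<open>z\<close> is at most the square root of
      \<open>\<delta>\<close> times the norm of \<open>Q z\<close>, which is at most
      \<open>C\<close>; this makes it \<open>\<epsilon> / 2\<close>.\<close>
    define \<delta> where "\<delta> = (\<epsilon> / (2 * C))\<^sup>2"
    have "\<delta> > 0" using \<epsilon> C unfolding \<delta>_def by simp
    then obtain F where F: "finite F" "F \<subseteq> E" "\<And>z. r F z < \<delta>" using dini by blast
    show "\<forall>\<^sub>F Y in finite_subsets_at_top E.
        dist (\<Sum>e\<in>Y. LINT z|M. l2_inner M (P z) e * cnj (l2_inner M (Q z) e))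
          (LINT z|M. l2_inner M (P z) (Q z)) < \<epsilon>"
      unfolding eventually_finite_subsets_at_top
    proof (intro exI[of _ F] conjI allI impI F)
      fix Y assume Y: "finite Y \<and> F \<subseteq> Y \<and> Y \<subseteq> E"
      have proj: "l2_projection M Y (P z) \<in> l2_space M" for z
        using Y by (intro l2_projection_in_l2_space[OF E]) auto
      have int: "integrable M (\<lambda>z. l2_inner M (P z) e * cnj (l2_inner M (Q z) e))" if "e \<in> Y" for e
        using that Y by (intro integrable_continuous_compact[OF M cpt] continuous_intros P_cont Q_cont El2) auto
      \<comment> \<open>Read this way, a partial sum differs from <P z, Q z> by the inner product of
        the residual of \<open>P z\<close> with \<open>Q z\<close>.\<close>
      have sum_eq: "(\<Sum>e\<in>Y. l2_inner M (P z) e * cnj (l2_inner M (Q z) e))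
          = l2_inner M (l2_projection M Y (P z)) (Q z)" for z
        unfolding l2_projection_def using Y
        by (subst l2_inner_sum_left)
          (auto intro!: l2_combination_terms[OF E, of Y] Ql2 simp: l2_inner_scale_left l2_inner_commute[symmetric])
      have PQ: "integrable M (\<lambda>z. l2_inner M (P z) (Q z))"
      proof (rule integrable_continuous_compact[OF M cpt])
        show "continuous_on UNIV (\<lambda>z. l2_inner M (P z) (Q z))"
          unfolding l2_inner_def
        proof (rule continuous_on_integral_dominated)
          show "integrable M (\<lambda>h. A * C)" by simp
          show "norm (P z h * cnj (Q z h)) \<le> A * C" for z h
            using PA[of z h] QC[of z h] A(1) by (auto simp: norm_mult intro: mult_mono)
        qed (intro meas continuous_intros contP contQ)+
      qed
      have bound: "cmod (l2_inner M (l2_projection M Y (P z)) (Q z) - l2_inner M (P z) (Q z)) \<le> \<epsilon> / 2" for z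
      proof (rule power2_le_imp_le)
        have "(cmod (l2_inner M (l2_projection M Y (P z)) (Q z) - l2_inner M (P z) (Q z)))\<^sup>2
            = (cmod (l2_inner M (\<lambda>x. P z x - l2_projection M Y (P z) x) (Q z)))\<^sup>2"
          by (subst l2_inner_diff_left[OF Pl2 proj Ql2]) (simp add: norm_minus_commute)
        also have "\<dots> \<le> r Y z * l2_sq M (Q z)"
          using l2_cauchy_schwarz[OF l2_space_diff[OF Pl2 proj] Ql2, of z z z] r_eq[of Y z] Y by simp
        also have "\<dots> \<le> \<delta> * C\<^sup>2"
        proof (intro mult_mono Qsq)
          show "r Y z \<le> \<delta>" using r_mono[of F Y z] F(3)[of z] Y by linarith
        qed (use \<open>\<delta> > 0\<close> in auto)
        also have "\<dots> = (\<epsilon> / 2)\<^sup>2" using C(1) by (simp add: \<delta>_def power2_eq_square)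
        finally show "(cmod (l2_inner M (l2_projection M Y (P z)) (Q z) - l2_inner M (P z) (Q z)))\<^sup>2 \<le> (\<epsilon> / 2)\<^sup>2" .
      qed (use \<epsilon> in simp)
      have pint: "integrable M (\<lambda>z. l2_inner M (l2_projection M Y (P z)) (Q z))"
        unfolding sum_eq[symmetric] by (intro Bochner_Integration.integrable_sum int)
      have "(\<Sum>e\<in>Y. LINT z|M. l2_inner M (P z) e * cnj (l2_inner M (Q z) e))
          - (LINT z|M. l2_inner M (P z) (Q z))
          = (LINT z|M. l2_inner M (l2_projection M Y (P z)) (Q z) - l2_inner M (P z) (Q z))"
        using int PQ pint by (simp add: sum_eq[symmetric])
      also have "cmod \<dots> \<le> (LINT z|M. \<epsilon> / 2)"
        using bound PQ pint by (intro order_trans[OF integral_norm_bound] integral_mono) auto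
      also have "\<dots> < \<epsilon>" using \<epsilon> by (simp add: prob_space)
      finally show "dist (\<Sum>e\<in>Y. LINT z|M. l2_inner M (P z) e * cnj (l2_inner M (Q z) e))
          (LINT z|M. l2_inner M (P z) (Q z)) < \<epsilon>"
        by (simp add: dist_norm)
    qed
  qed
qed

section \<open>Haar measure on a compact group\<close>

text \<open>With no metric given, the distance to \<open>C\<close> is replaced by Urysohn functions,
  available because compact Hausdorff spaces are normal. Second countability, through Lindelof,
  reduces the separation of \<open>C\<close> from all outside points to countably many of
  them.\<close>

lemma closed_indicator_limit:
  fixes C :: "'a::{t2_space, second_countable_topology} set"
  assumes cpt: "compact (UNIV :: 'a set)" and C: "closed C"
  obtains v :: "nat \<Rightarrow> 'a \<Rightarrow> real"
  where "\<And>n. continuous_on UNIV (v n)" "\<And>n x. 0 \<le> v n x \<and> v n x \<le> 1"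
    "\<And>x. (\<lambda>n. v n x) \<longlonglongrightarrow> indicator C x"
proof -
  have "Hausdorff_space (euclidean :: 'a topology)"
    unfolding Hausdorff_space_def disjnt_def using separation_t2 by (metis open_openin)
  moreover have "compact_space (euclidean :: 'a topology)"
    using cpt by (simp add: compact_space_def)
  ultimately have normal: "normal_space (euclidean :: 'a topology)"
    by (simp add: compact_Hausdorff_or_regular_imp_normal_space)
  define admissible where "admissible u \<longleftrightarrow>
    continuous_on UNIV u \<and> (\<forall>x. 0 \<le> u x \<and> u x \<le> 1) \<and> (\<forall>x\<in>C. u x = 1)" for u :: "'a \<Rightarrow> real"
  define \<U> where "\<U> = {{x. u x < 1/2} | u. admissible u}"
  have "open {x. u x < 1/2}" if "admissible u" for u
    using that unfolding admissible_def by (intro open_Collect_less continuous_intros) auto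
  then have "open S" if "S \<in> \<U>" for S
    using that unfolding \<U>_def by blast
  then obtain \<V> where \<V>: "\<V> \<subseteq> \<U>" "countable \<V>" "\<Union>\<V> = \<Union>\<U>"
    using Lindelof[of \<U>] by blast
  have cover: "\<exists>S\<in>\<V>. x \<in> S" if x: "x \<notin> C" for x
  proof -
    obtain f where f: "continuous_map euclidean (top_of_set {0..1::real}) f" "f ` {x} \<subseteq> {0}" "f ` C \<subseteq> {1}"
      using Urysohn_lemma[OF normal, of "{x}" C 0 1] x C by (auto simp: disjnt_def)
    have "continuous_on UNIV f" "\<And>y. f y \<in> {0..1}"
      using f(1) by (auto simp: continuous_map_in_subtopology)
    then have "admissible f" using f(3) unfolding admissible_def by auto
    moreover have "x \<in> {y. f y < 1/2}" using f(2) by simp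
    ultimately have "x \<in> \<Union>\<U>" unfolding \<U>_def by blast
    then show ?thesis using \<V>(3) by blast
  qed
  \<comment> \<open>The constant 1 contributes the empty set, which keeps the countable family
    nonempty, so that it can be enumerated even if \<open>\<V>\<close> is empty.\<close>
  have "admissible (\<lambda>_. 1)" unfolding admissible_def by simp
  then have one: "{} \<in> \<U>" unfolding \<U>_def by force
  define S where "S = from_nat_into (insert {} \<V>)"
  have range_S: "range S = insert {} \<V>"
    unfolding S_def using \<V>(2) by (intro range_from_nat_into) auto
  have "\<forall>n. \<exists>u. admissible u \<and> S n = {x. u x < 1/2}"
  proof
    fix n
    have "S n \<in> insert {} \<V>" unfolding range_S[symmetric] by (rule rangeI)
    then have "S n \<in> \<U>" using one \<V>(1) by auto
    then show "\<exists>u. admissible u \<and> S n = {x. u x < 1/2}" unfolding \<U>_def by blast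
  qed
  then obtain u where "\<forall>n. admissible (u n) \<and> S n = {x. u n x < 1/2}"
    by atomize_elim (rule choice)
  then have u: "continuous_on UNIV (u n)" "0 \<le> u n x" "u n x \<le> 1" "y \<in> C \<Longrightarrow> u n y = 1"
    "S n = {x. u n x < 1/2}" for n x y
    unfolding admissible_def by blast+
  \<comment> \<open>On \<open>C\<close> every factor is 1. Off \<open>C\<close> some factor is below
    1/2, hence so is the product from that index on, and the exponent \<open>n\<close> drives it to
    0.\<close>
  define v where "v n x = (\<Prod>i\<le>n. u i x) ^ n" for n x
  have prod01: "0 \<le> (\<Prod>i\<le>n. u i x)" "(\<Prod>i\<le>n. u i x) \<le> 1" for n x
    using u by (auto intro: prod_nonneg prod_le_1)
  have lim: "(\<lambda>n. v n x) \<longlonglongrightarrow> indicator C x" for x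
  proof (cases "x \<in> C")
    case True
    then show ?thesis using u(4) unfolding v_def by simp
  next
    case False
    then obtain j where j: "u j x < 1/2"
      using cover[OF False] range_S u(5) by (metis (mono_tags, lifting) image_iff insertI2 mem_Collect_eq)
    have le: "v n x \<le> (1/2) ^ n" if "j \<le> n" for n
    proof -
      have "(\<Prod>i\<le>n. u i x) = u j x * (\<Prod>i\<in>{..n} - {j}. u i x)"
        using that by (intro prod.remove) auto
      also have "\<dots> \<le> u j x * 1"
        using u by (intro mult_left_mono prod_le_1) auto
      finally have "(\<Prod>i\<le>n. u i x) \<le> 1/2" using j by simp
      then show ?thesis unfolding v_def using prod01 by (intro power_mono) auto
    qed
    have "(\<lambda>n. v n x) \<longlonglongrightarrow> 0"
    proof (rule tendsto_sandwich)
      show "\<forall>\<^sub>F n in sequentially. 0 \<le> v n x" unfolding v_def using prod01 by simp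
      show "\<forall>\<^sub>F n in sequentially. v n x \<le> (1/2) ^ n"
        using le by (auto simp: eventually_sequentially)
      show "(\<lambda>n. (1/2) ^ n :: real) \<longlonglongrightarrow> 0" by (rule LIMSEQ_power_zero) simp
    qed simp
    then show ?thesis using False by simp
  qed
  show thesis
  proof
    show "continuous_on UNIV (v n)" for n
      unfolding v_def by (intro continuous_intros u)
    show "0 \<le> v n x \<and> v n x \<le> 1" for n x
      unfolding v_def using prod01 by (auto intro: power_le_one)
  qed (rule lim)
qed

text \<open>The closed sets are stable under intersection and generate the Borel sets; on them the
  measures agree by dominated convergence along \<open>closed_indicator_limit\<close>.\<close>

lemma borel_prob_eqI_continuous:
  fixes N N' :: "'a::{t2_space, second_countable_topology} measure"
  assumes cpt: "compact (UNIV :: 'a set)"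
    and N: "prob_space N" "sets N = sets borel" and N': "prob_space N'" "sets N' = sets borel"
    and eq: "\<And>u :: 'a \<Rightarrow> real. continuous_on UNIV u \<Longrightarrow> (LINT x|N. u x) = (LINT x|N'. u x)"
  shows "N = N'"
proof (rule measure_eqI_generator_eq[where E = "Collect closed" and \<Omega> = UNIV and A = "\<lambda>_. UNIV"])
  interpret N: prob_space N by fact
  interpret N': prob_space N' by fact
  show "Int_stable (Collect closed :: 'a set set)" by (auto simp: Int_stable_def)
  show "sets N = sigma_sets UNIV (Collect closed)" "sets N' = sigma_sets UNIV (Collect closed)"
    using N(2) N'(2) by (simp_all add: borel_eq_closed)
  show "emeasure N UNIV \<noteq> \<infinity>" by simp
  fix C :: "'a set" assume "C \<in> Collect closed"
  then have C: "closed C" by simp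
  then obtain v :: "nat \<Rightarrow> 'a \<Rightarrow> real"
    where v: "\<And>n. continuous_on UNIV (v n)" "\<And>n x. 0 \<le> v n x \<and> v n x \<le> 1"
      "\<And>x. (\<lambda>n. v n x) \<longlonglongrightarrow> indicator C x"
    using closed_indicator_limit[OF cpt] by metis
  have lim: "(\<lambda>n. LINT x|K. v n x) \<longlonglongrightarrow> measure K C" if K: "prob_space K" "sets K = sets borel" for K
  proof -
    interpret K: prob_space K by fact
    have C_sets: "C \<in> sets K" using C K(2) by simp
    have "(\<lambda>n. LINT x|K. v n x) \<longlonglongrightarrow> (LINT x|K. indicator C x)"
    proof (rule integral_dominated_convergence[where w = "\<lambda>_. 1"])
      show "v n \<in> borel_measurable K" for n
        using borel_measurable_continuous_onI[OF v(1)] measurable_cong_sets[OF K(2) refl] by blast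
    qed (use v C_sets in auto)
    then show ?thesis using C_sets by simp
  qed
  have "measure N C = measure N' C"
    using LIMSEQ_unique[OF lim[OF N]] lim[OF N'] eq[OF v(1)] by simp
  then show "emeasure N C = emeasure N' C"
    by (simp add: N.emeasure_eq_measure N'.emeasure_eq_measure)
qed auto

text \<open>Setting for the analysis on the group. \<open>normalised_haar\<close> postulates left
  invariance; invariance under inversion and right translation is derived from compactness and mass
  one.\<close>

locale compact_haar_group = group G
  for G :: "'g::{t2_space, second_countable_topology} monoid" (structure) +
  fixes M :: "'g measure"
  assumes carrier_UNIV: "carrier G = UNIV"
    and continuous_mult: "continuous_on UNIV (\<lambda>(g, h). g \<otimes> h)"
    and continuous_inv: "continuous_on UNIV (\<lambda>g. inv g)"
    and compact_UNIV: "compact (UNIV :: 'g set)"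
    and haar: "normalised_haar G M"
begin

lemma in_carrier [simp]: "g \<in> carrier G"
  by (simp add: carrier_UNIV)

lemma mult_inv_cancel [simp]: "g \<otimes> (inv g \<otimes> h) = h" "inv g \<otimes> (g \<otimes> h) = h"
  by (simp_all flip: m_assoc)

lemma prob_haar: "prob_space M"
  using haar by (simp add: normalised_haar_def)

lemma sets_haar [measurable_cong]: "sets M = sets borel"
  using haar by (simp add: normalised_haar_def)

lemma space_haar [simp]: "space M = UNIV"
  using sets_eq_imp_space_eq[OF sets_haar] by simp

sublocale prob_space M
  by (rule prob_haar)

lemma prob_UNIV [simp]: "prob UNIV = 1"
  using prob_space by simp

lemma continuous_on_mult_group [continuous_intros]:
  "continuous_on S f \<Longrightarrow> continuous_on S h \<Longrightarrow> continuous_on S (\<lambda>x. f x \<otimes> h x)"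
  using continuous_on_compose2[OF continuous_mult continuous_on_Pair, of S f h] by simp

lemma continuous_on_inv_group [continuous_intros]:
  "continuous_on S f \<Longrightarrow> continuous_on S (\<lambda>x. inv (f x))"
  using continuous_on_compose2[OF continuous_inv] by simp

lemma measurable_mult_group [measurable (raw)]:
  assumes "f \<in> borel_measurable N" "h \<in> borel_measurable N"
  shows "(\<lambda>x. f x \<otimes> h x) \<in> borel_measurable N"
  using borel_measurable_continuous_Pair[OF assms, of "(\<otimes>)"] continuous_mult
  by (simp add: split_beta')

lemma measurable_inv_group [measurable (raw)]:
  "f \<in> borel_measurable N \<Longrightarrow> (\<lambda>x. inv (f x)) \<in> borel_measurable N"
  using measurable_compose[OF _ borel_measurable_continuous_onI[OF continuous_inv]] .

lemma haar_left: "distr M borel (\<lambda>h. g \<otimes> h) = M"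
  using haar by (simp add: normalised_haar_def)

lemma integral_haar_left:
  fixes f :: "'g \<Rightarrow> 'b::{banach, second_countable_topology}"
  assumes [measurable]: "f \<in> borel_measurable borel"
  shows "(LINT h|M. f (g \<otimes> h)) = (LINT h|M. f h)"
  by (subst (2) haar_left[of g, symmetric], subst integral_distr) auto

lemma integrable_haar_left:
  fixes f :: "'g \<Rightarrow> 'b::{banach, second_countable_topology}"
  assumes [measurable]: "f \<in> borel_measurable borel"
  shows "integrable M (\<lambda>h. f (g \<otimes> h)) \<longleftrightarrow> integrable M f"
  by (subst (2) haar_left[of g, symmetric], subst integrable_distr_eq) auto

lemma integrable_continuous:
  fixes f :: "'g \<Rightarrow> 'b::{banach, second_countable_topology}"
  assumes "continuous_on UNIV f"
  shows "integrable M f"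
  using integrable_continuous_compact[OF prob_haar sets_haar compact_UNIV assms] .

lemma integrable_continuous_pair:
  fixes f :: "'g \<times> 'g \<Rightarrow> 'b::{banach, second_countable_topology}"
  assumes "prob_space N" "sets N = sets borel" "prob_space N'" "sets N' = sets borel"
    "continuous_on UNIV f"
  shows "integrable (N \<Otimes>\<^sub>M N') f"
proof -
  interpret N: prob_space N by fact
  interpret N': prob_space N' by fact
  interpret pair_prob_space N N' ..
  have "sets (N \<Otimes>\<^sub>M N') = sets borel"
    by (rule trans[OF sets_pair_measure_cong[OF assms(2,4)] arg_cong[OF borel_prod, of sets]])
  then show ?thesis
    using integrable_continuous_compact[OF _ _ compact_UNIV_prod[OF compact_UNIV compact_UNIV] assms(5)]
      prob_space_axioms by blast
qed

lemma fubini_continuous: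
  fixes f :: "'g \<Rightarrow> 'g \<Rightarrow> 'b::{banach, second_countable_topology}"
  assumes N: "prob_space N" "sets N = sets borel" "prob_space N'" "sets N' = sets borel"
    and f: "continuous_on UNIV (\<lambda>(g, h). f g h)"
  shows "(LINT h|N'. LINT g|N. f g h) = (LINT g|N. LINT h|N'. f g h)"
proof -
  interpret N: prob_space N by fact
  interpret N': prob_space N' by fact
  interpret pair_prob_space N N' ..
  show ?thesis by (rule Fubini_integral) (rule integrable_continuous_pair[OF N f])
qed

text \<open>Averaging over a dummy variable \<open>h\<close> allows left invariance to be used
  twice: replacing \<open>g\<close> by \<open>inv h \<otimes> g\<close> creates the integrand
  \<open>u (inv g \<otimes> h)\<close>, and after exchanging the integrals the factor
  \<open>inv g\<close> is absorbed in the variable \<open>h\<close>.\<close>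

lemma haar_inv: "distr M borel (\<lambda>g. inv g) = M"
proof (rule borel_prob_eqI_continuous[OF compact_UNIV _ _ prob_haar sets_haar])
  show "prob_space (distr M borel (\<lambda>g. inv g))" by (rule prob_space_distr) simp
  fix u :: "'g \<Rightarrow> real" assume u: "continuous_on UNIV u"
  then have [measurable]: "u \<in> borel_measurable borel" by (rule borel_measurable_continuous_onI)
  have inv_mult: "inv (inv h \<otimes> g) = inv g \<otimes> h" for g h by (simp add: inv_mult_group)
  have "(LINT g|distr M borel (\<lambda>g. inv g). u g) = (LINT h|M. LINT g|M. u (inv g))"
    by (simp add: integral_distr prob_space)
  also have "\<dots> = (LINT h|M. LINT g|M. u (inv g \<otimes> h))"
    using integral_haar_left[of "\<lambda>g. u (inv g)" "inv h" for h] by (simp add: inv_mult)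
  also have "\<dots> = (LINT g|M. LINT h|M. u (inv g \<otimes> h))"
  proof (rule fubini_continuous[OF prob_haar sets_haar prob_haar sets_haar])
    show "continuous_on UNIV (\<lambda>(g, h). u (inv g \<otimes> h))"
      unfolding split_beta' by (intro continuous_on_compose2[OF u] continuous_intros) auto
  qed
  also have "\<dots> = (LINT h|M. u h)"
    by (simp add: integral_haar_left prob_space)
  finally show "(LINT g|distr M borel (\<lambda>g. inv g). u g) = (LINT g|M. u g)" .
qed simp

lemma integral_haar_inv:
  fixes f :: "'g \<Rightarrow> 'b::{banach, second_countable_topology}"
  assumes [measurable]: "f \<in> borel_measurable borel"
  shows "(LINT h|M. f (inv h)) = (LINT h|M. f h)"
  by (subst (2) haar_inv[symmetric], subst integral_distr) auto

lemma integral_haar_right: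
  fixes f :: "'g \<Rightarrow> 'b::{banach, second_countable_topology}"
  assumes [measurable]: "f \<in> borel_measurable borel"
  shows "(LINT h|M. f (h \<otimes> g)) = (LINT h|M. f h)"
proof -
  have "(LINT h|M. f (h \<otimes> g)) = (LINT h|M. f (inv (inv g \<otimes> h)))"
    using integral_haar_inv[of "\<lambda>h. f (h \<otimes> g)"] by (simp add: inv_mult_group)
  also have "\<dots> = (LINT h|M. f h)"
    using integral_haar_left[of "\<lambda>h. f (inv h)" "inv g"] integral_haar_inv[of f] by simp
  finally show ?thesis .
qed

text \<open>If \<open>f\<close> were positive somewhere, finitely many translates of the open set
  where it is positive would cover the compact group. The sum of these translates of
  \<open>f\<close> would be positive everywhere and yet have integral 0.\<close>

lemma haar_full_support:
  fixes f :: "'g \<Rightarrow> real"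
  assumes f: "continuous_on UNIV f" "\<And>g. f g \<ge> 0" and int: "(LINT g|M. f g) = 0"
  shows "f g = 0"
proof (rule ccontr)
  assume "f g \<noteq> 0"
  then have pos: "f g > 0" using f(2)[of g] by simp
  have meas: "f \<in> borel_measurable borel" by (rule borel_measurable_continuous_onI[OF f(1)])
  have trans: "continuous_on UNIV (\<lambda>x. f (h \<otimes> x))" for h
    by (intro continuous_on_compose2[OF f(1)] continuous_intros) auto
  have "UNIV \<subseteq> (\<Union>h\<in>UNIV. {x. f (h \<otimes> x) > 0})"
  proof
    fix x
    have "f ((g \<otimes> inv x) \<otimes> x) > 0" using pos by (simp add: m_assoc)
    then show "x \<in> (\<Union>h\<in>UNIV. {x. f (h \<otimes> x) > 0})" by blast
  qed
  moreover have "open {x. f (h \<otimes> x) > 0}" for h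
    by (intro open_Collect_less continuous_intros trans)
  ultimately obtain H where H: "finite H" "UNIV \<subseteq> (\<Union>h\<in>H. {x. f (h \<otimes> x) > 0})"
    using compactE_image[OF compact_UNIV] by (metis (no_types, lifting))
  have "(LINT x|M. (\<Sum>h\<in>H. f (h \<otimes> x))) = (\<Sum>h\<in>H. (LINT x|M. f x))"
    using integrable_continuous[OF trans] integral_haar_left[OF meas] by simp
  also have "\<dots> = 0" using int by simp
  finally have "AE x in M. (\<Sum>h\<in>H. f (h \<otimes> x)) = 0"
    using f(2) integrable_continuous[OF trans]
    by (subst (asm) integral_nonneg_eq_0_iff_AE) (auto intro!: sum_nonneg)
  moreover have "(\<Sum>h\<in>H. f (h \<otimes> x)) > 0" for x
  proof -
    obtain h where "h \<in> H" "f (h \<otimes> x) > 0" using H(2) by blast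
    then show ?thesis using H(1) f(2) by (intro sum_pos2) auto
  qed
  ultimately have "AE x in M. False" by (simp add: less_le)
  then show False by simp
qed

text \<open>The difference of the two functions is itself the only test function required. Thus
  equality can be concluded even when integrals are known only against a restricted class, provided
  the difference lies in it.\<close>

lemma continuous_eqI_haar:
  fixes f f' :: "'g \<Rightarrow> real"
  assumes f: "continuous_on UNIV f" "continuous_on UNIV f'"
    and int: "(LINT g|M. (f g - f' g) * f g) = (LINT g|M. (f g - f' g) * f' g)"
  shows "f g = f' g"
proof -
  have "integrable M (\<lambda>g. (f g - f' g) * f g)" "integrable M (\<lambda>g. (f g - f' g) * f' g)"
    by (intro integrable_continuous continuous_intros f)+
  then have "(LINT g|M. (f g - f' g) * (f g - f' g)) = 0"
    using int by (simp add: right_diff_distrib)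
  then have "(f g - f' g) * (f g - f' g) = 0"
    by (intro haar_full_support[of "\<lambda>g. (f g - f' g) * (f g - f' g)"] continuous_intros f) auto
  then show ?thesis by simp
qed

end

section \<open>Convolution operators with continuous densities\<close>

context compact_haar_group
begin

lemma borel_measurable_haar: "borel_measurable M = borel_measurable borel"
  by (rule measurable_cong_sets[OF sets_haar refl])

lemma l2_space_measurable: "f \<in> l2_space M \<Longrightarrow> f \<in> borel_measurable borel"
  using l2_spaceD(1) borel_measurable_haar by blast

lemma integral_density_haar:
  fixes f :: "'g \<Rightarrow> 'b::{banach, second_countable_topology}"
  assumes "continuous_on UNIV \<psi>" "\<And>h. 0 \<le> \<psi> h" "f \<in> borel_measurable borel"
  shows "(LINT h|density M (\<lambda>h. ennreal (\<psi> h)). f h) = (LINT h|M. \<psi> h *\<^sub>R f h)"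
  using assms borel_measurable_continuous_onI[OF assms(1)]
  by (intro integral_density) (auto simp: borel_measurable_haar)

lemma integrable_density_haar:
  fixes f :: "'g \<Rightarrow> 'b::{banach, second_countable_topology}"
  assumes \<psi>: "continuous_on UNIV \<psi>" "\<And>h. 0 \<le> \<psi> h" and f: "f \<in> borel_measurable borel" "integrable M f"
  shows "integrable (density M (\<lambda>h. ennreal (\<psi> h))) f"
proof -
  have [measurable]: "\<psi> \<in> borel_measurable borel" "f \<in> borel_measurable borel"
    using borel_measurable_continuous_onI[OF \<psi>(1)] f by auto
  obtain C where C: "\<And>x. norm (\<psi> x) \<le> C" using compact_UNIV_norm_bound[OF compact_UNIV \<psi>(1)] by blast
  have "integrable M (\<lambda>h. \<psi> h *\<^sub>R f h)"
  proof (rule Bochner_Integration.integrable_bound)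
    show "integrable M (\<lambda>h. C * norm (f h))" using f by simp
    have "\<bar>\<psi> h\<bar> \<le> \<bar>C\<bar>" for h using C[of h] by simp
    then show "AE h in M. norm (\<psi> h *\<^sub>R f h) \<le> norm (C * norm (f h))"
      by (auto simp: abs_mult intro!: mult_right_mono)
  qed simp
  then show ?thesis using \<psi> by (subst integrable_density) auto
qed

lemma group_convolution_integral:
  fixes f :: "'g \<Rightarrow> 'b::{banach, second_countable_topology}"
  assumes N: "prob_space N" "sets N = sets borel"
    and f: "f \<in> borel_measurable borel" "integrable (group_convolution G N N) f"
  shows "(LINT x|group_convolution G N N. f x) = (LINT a|N. LINT b|N. f (a \<otimes> b))"
proof -
  interpret N: prob_space N by fact
  interpret N2: pair_prob_space N N ..
  have [measurable_cong]: "sets N = sets borel" by fact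
  have [measurable]: "f \<in> borel_measurable borel" by fact
  have mult: "(\<lambda>(a, b). a \<otimes> b) \<in> borel_measurable (N \<Otimes>\<^sub>M N)" by measurable
  have "integrable (N \<Otimes>\<^sub>M N) (\<lambda>p. f (case p of (a, b) \<Rightarrow> a \<otimes> b))"
    using f(2) unfolding group_convolution_def by (subst (asm) integrable_distr_eq[OF mult]) auto
  from N2.integral_fst'[OF this] show ?thesis
    unfolding group_convolution_def by (subst integral_distr[OF mult]) auto
qed

section \<open>Convolution operators with a continuous density\<close>

context
  fixes \<psi> :: "'g \<Rightarrow> real"
  assumes \<psi>_cont: "continuous_on UNIV \<psi>" and \<psi>_nonneg: "\<And>h. 0 \<le> \<psi> h"
begin

lemma convolution_operator_kernel:
  assumes "f \<in> borel_measurable borel"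
  shows "convolution_operator G (density M (\<lambda>h. ennreal (\<psi> h))) f g
    = (LINT h|M. complex_of_real (\<psi> (inv g \<otimes> h)) * f h)"
proof -
  have [measurable]: "\<psi> \<in> borel_measurable borel" "f \<in> borel_measurable borel"
    using borel_measurable_continuous_onI[OF \<psi>_cont] assms by auto
  \<comment> \<open>Inserting \<open>inv g \<otimes> g\<close> displays the integrand as a function
    of \<open>g \<otimes> h\<close>, ready for left invariance.\<close>
  have "convolution_operator G (density M (\<lambda>h. ennreal (\<psi> h))) f g
      = (LINT h|M. complex_of_real (\<psi> (inv g \<otimes> (g \<otimes> h))) * f (g \<otimes> h))"
    unfolding convolution_operator_def
    by (subst integral_density_haar[OF \<psi>_cont \<psi>_nonneg]) (auto simp: scaleR_conv_of_real)
  also have "\<dots> = (LINT h|M. complex_of_real (\<psi> (inv g \<otimes> h)) * f h)"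
    by (rule integral_haar_left[where f = "\<lambda>h. complex_of_real (\<psi> (inv g \<otimes> h)) * f h"]) measurable
  finally show ?thesis .
qed

text \<open>The bound is pointwise in \<open>g\<close> and by the mean of the modulus of
  \<open>f\<close>: it gives both boundedness on the Hilbert space and the domination needed for
  Fubini.\<close>

lemma convolution_operator_bound:
  obtains C where "C > 0" "\<And>h. \<psi> h \<le> C"
    "\<And>f g. f \<in> l2_space M \<Longrightarrow>
      cmod (convolution_operator G (density M (\<lambda>h. ennreal (\<psi> h))) f g) \<le> C * (LINT h|M. cmod (f h))"
proof -
  obtain C where C: "C > 0" "\<And>x. norm (\<psi> x) \<le> C"
    using compact_UNIV_norm_bound[OF compact_UNIV \<psi>_cont] by blast
  have "cmod (convolution_operator G (density M (\<lambda>h. ennreal (\<psi> h))) f g) \<le> C * (LINT h|M. cmod (f h))"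
    if f: "f \<in> l2_space M" for f g
  proof -
    have [measurable]: "\<psi> \<in> borel_measurable borel" "f \<in> borel_measurable borel"
      using borel_measurable_continuous_onI[OF \<psi>_cont] l2_space_measurable[OF f] by auto
    have le: "cmod (complex_of_real (\<psi> (inv g \<otimes> h)) * f h) \<le> C * cmod (f h)" for h
      using C(2)[of "inv g \<otimes> h"] by (auto simp: norm_mult intro: mult_right_mono)
    have intC: "integrable M (\<lambda>h. C * cmod (f h))" using l2_space_integrable[OF f] by simp
    have int: "integrable M (\<lambda>h. complex_of_real (\<psi> (inv g \<otimes> h)) * f h)"
      by (rule Bochner_Integration.integrable_bound[OF intC]) (use le C(1) in \<open>auto simp: abs_mult\<close>)
    have "cmod (convolution_operator G (density M (\<lambda>h. ennreal (\<psi> h))) f g) \<le> (LINT h|M. C * cmod (f h))"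
      unfolding convolution_operator_kernel[OF l2_space_measurable[OF f]]
      using le int intC by (intro order_trans[OF integral_norm_bound] integral_mono) auto
    then show ?thesis by simp
  qed
  moreover have "\<psi> h \<le> C" for h using C(2)[of h] by simp
  ultimately show thesis using that C(1) by blast
qed

lemma convolution_operator_measurable:
  assumes "f \<in> l2_space M"
  shows "convolution_operator G (density M (\<lambda>h. ennreal (\<psi> h))) f \<in> borel_measurable borel"
proof -
  have [measurable]: "\<psi> \<in> borel_measurable borel" "f \<in> borel_measurable borel"
    using borel_measurable_continuous_onI[OF \<psi>_cont] l2_space_measurable[OF assms] by auto
  show ?thesis
    unfolding convolution_operator_kernel[OF l2_space_measurable[OF assms], abs_def] by measurable
qed

lemma l2_bounded_convolution_operator:
  "l2_bounded_operator M (convolution_operator G (density M (\<lambda>h. ennreal (\<psi> h))))"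
proof -
  let ?T = "convolution_operator G (density M (\<lambda>h. ennreal (\<psi> h)))"
  obtain C where C: "C > 0" "\<And>h. \<psi> h \<le> C" and
    bound: "\<And>f g. f \<in> l2_space M \<Longrightarrow> cmod (?T f g) \<le> C * (LINT h|M. cmod (f h))"
    using convolution_operator_bound by metis
  have sq: "(cmod (?T f g))\<^sup>2 \<le> C\<^sup>2 * l2_sq M f" if f: "f \<in> l2_space M" for f g
  proof -
    have "(cmod (?T f g))\<^sup>2 \<le> (C * (LINT h|M. cmod (f h)))\<^sup>2"
      using bound[OF f] by (intro power_mono) auto
    also have "\<dots> \<le> C\<^sup>2 * l2_sq M f"
      using expectation_cmod_sq_le[OF f] by (simp add: power_mult_distrib mult_left_mono)
    finally show ?thesis .
  qed
  have meas: "?T f \<in> borel_measurable M" if "f \<in> l2_space M" for f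
    using convolution_operator_measurable[OF that] borel_measurable_haar by blast
  have l2: "?T f \<in> l2_space M" if "f \<in> l2_space M" for f
  proof -
    have "integrable M (\<lambda>g. (cmod (?T f g))\<^sup>2)"
      using sq[OF that] meas[OF that] by (intro integrable_const_bound[of _ "C\<^sup>2 * l2_sq M f"]) auto
    then show ?thesis using meas[OF that] by (simp add: l2_space_def)
  qed
  have lin: "?T (\<lambda>x. a * f x + b * h x) g = a * ?T f g + b * ?T h g"
    if f: "f \<in> l2_space M" and h: "h \<in> l2_space M" for f h a b g
  proof -
    have int: "integrable M (\<lambda>x. complex_of_real (\<psi> (inv g \<otimes> x)) * u x)" if u: "u \<in> l2_space M" for u
    proof (rule l2_mult_integrable[OF _ u])
      have cont: "continuous_on UNIV (\<lambda>x. \<psi> (inv g \<otimes> x))"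
        by (intro continuous_intros continuous_on_compose2[OF \<psi>_cont]) auto
      then have "integrable M (\<lambda>x. (\<psi> (inv g \<otimes> x))\<^sup>2)"
        by (intro integrable_continuous continuous_intros)
      then show "(\<lambda>x. complex_of_real (\<psi> (inv g \<otimes> x))) \<in> l2_space M"
        using borel_measurable_continuous_onI[OF cont] by (simp add: l2_space_def borel_measurable_haar)
    qed
    have [measurable]: "f \<in> borel_measurable borel" "h \<in> borel_measurable borel"
      using l2_space_measurable f h by auto
    have "?T (\<lambda>x. a * f x + b * h x) g
        = (LINT x|M. a * (complex_of_real (\<psi> (inv g \<otimes> x)) * f x) + b * (complex_of_real (\<psi> (inv g \<otimes> x)) * h x))"
      by (subst convolution_operator_kernel) (auto simp: algebra_simps)
    also have "\<dots> = a * ?T f g + b * ?T h g"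
      using int[OF f] int[OF h] by (simp add: convolution_operator_kernel)
    finally show ?thesis .
  qed
  have "l2_sq M (?T f) \<le> C\<^sup>2 * l2_sq M f" if f: "f \<in> l2_space M" for f
  proof -
    have "l2_sq M (?T f) \<le> (LINT g|M. C\<^sup>2 * l2_sq M f)"
      using sq[OF f] l2_spaceD(2)[OF l2[OF f]] by (intro integral_mono) auto
    then show ?thesis by simp
  qed
  then show ?thesis
    unfolding l2_bounded_operator_def using l2 lin by (intro conjI exI[of _ "C\<^sup>2"]) auto
qed

end

text \<open>The operator of \<open>N * N\<close> is the square of that of \<open>N\<close>, so its diagonal entries are the integrals
  of \<open>\<langle>P z, e\<rangle> \<langle>e, Q z\<rangle>\<close> over \<open>z\<close>, where \<open>P z h = \<phi> (h\<^sup>-\<^sup>1 z)\<close> and \<open>Q z h = \<phi> (z\<^sup>-\<^sup>1 h)\<close>.\<close>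

context
  fixes \<phi> \<psi> :: "'g \<Rightarrow> real" and N :: "'g measure"
  assumes \<phi>_cont: "continuous_on UNIV \<phi>" and \<phi>_nonneg: "\<And>h. 0 \<le> \<phi> h"
    and \<psi>_cont: "continuous_on UNIV \<psi>" and \<psi>_nonneg: "\<And>h. 0 \<le> \<psi> h"
    and prob_N: "prob_space N" and N_density: "N = density M (\<lambda>h. ennreal (\<phi> h))"
    and NN_density: "group_convolution G N N = density M (\<lambda>h. ennreal (\<psi> h))"
begin

lemma sets_N: "sets N = sets borel"
  unfolding N_density by (simp add: sets_haar)

text \<open>Both sides are continuous densities of the same measure. Continuity makes the identity
  pointwise, so that it can be evaluated at \<open>\<one>\<close>.\<close>

lemma convolution_density_eq: "\<psi> x = (LINT h|M. \<phi> h * \<phi> (inv h \<otimes> x))"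
proof (rule continuous_eqI_haar[OF \<psi>_cont])
  let ?c = "\<lambda>x. LINT h|M. \<phi> h * \<phi> (inv h \<otimes> x)"
  have cont: "continuous_on UNIV (\<lambda>(x, h). \<phi> h * \<phi> (inv h \<otimes> x))"
    unfolding split_beta' by (intro continuous_intros continuous_on_compose2[OF \<phi>_cont]) auto
  obtain B where B: "\<And>p. norm (case p of (x, h) \<Rightarrow> \<phi> h * \<phi> (inv h \<otimes> x)) \<le> B"
    using compact_UNIV_norm_bound[OF compact_UNIV_prod[OF compact_UNIV compact_UNIV] cont] by blast
  show c_cont: "continuous_on UNIV ?c"
  proof (rule continuous_on_integral_dominated[where w = "\<lambda>_. B"])
    show "(\<lambda>h. \<phi> h * \<phi> (inv h \<otimes> x)) \<in> borel_measurable M" for x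
      unfolding borel_measurable_haar
      using continuous_on_curried(1)[OF cont] by (rule borel_measurable_continuous_onI)
    show "continuous_on UNIV (\<lambda>x. \<phi> h * \<phi> (inv h \<otimes> x))" for h
      using continuous_on_curried(2)[OF cont] by simp
    show "norm (\<phi> h * \<phi> (inv h \<otimes> x)) \<le> B" for x h using B[of "(x, h)"] by simp
  qed simp
  have eq: "(LINT x|M. u x * \<psi> x) = (LINT x|M. u x * ?c x)" if u: "continuous_on UNIV u" for u
  proof -
    have [measurable]: "u \<in> borel_measurable borel" "\<phi> \<in> borel_measurable borel"
      using u \<phi>_cont by (auto intro: borel_measurable_continuous_onI)
    have uab: "continuous_on UNIV (\<lambda>(a, b). \<phi> a * \<phi> (inv a \<otimes> b) * u b)"
      unfolding split_beta'
      by (intro continuous_intros continuous_on_compose2[OF \<phi>_cont] continuous_on_compose2[OF u]) auto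
    have inner: "(LINT b|N. u (a \<otimes> b)) = (LINT b|M. \<phi> (inv a \<otimes> b) * u b)" for a
      unfolding N_density
      using integral_haar_left[of "\<lambda>b. \<phi> (inv a \<otimes> b) * u b" a]
      by (subst integral_density_haar[OF \<phi>_cont \<phi>_nonneg]) auto
    have "(LINT x|M. u x * \<psi> x) = (LINT x|group_convolution G N N. u x)"
      unfolding NN_density by (subst integral_density_haar[OF \<psi>_cont \<psi>_nonneg]) (auto simp: mult.commute)
    also have "\<dots> = (LINT a|N. LINT b|N. u (a \<otimes> b))"
      using integrable_density_haar[OF \<psi>_cont \<psi>_nonneg _ integrable_continuous[OF u]]
      by (intro group_convolution_integral[OF prob_N sets_N]) (auto simp: NN_density)
    also have "\<dots> = (LINT a|M. \<phi> a * (LINT b|M. \<phi> (inv a \<otimes> b) * u b))"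
      unfolding inner by (subst (1) N_density, subst integral_density_haar[OF \<phi>_cont \<phi>_nonneg]) auto
    also have "\<dots> = (LINT a|M. LINT b|M. \<phi> a * \<phi> (inv a \<otimes> b) * u b)"
      by (simp add: mult.assoc)
    also have "\<dots> = (LINT b|M. LINT a|M. \<phi> a * \<phi> (inv a \<otimes> b) * u b)"
      by (rule fubini_continuous[symmetric, OF prob_haar sets_haar prob_haar sets_haar uab])
    also have "\<dots> = (LINT x|M. u x * ?c x)"
      by (simp add: mult.commute)
    finally show ?thesis .
  qed
  show "(LINT x|M. (\<psi> x - ?c x) * \<psi> x) = (LINT x|M. (\<psi> x - ?c x) * ?c x)"
    by (intro eq continuous_intros \<psi>_cont c_cont)
qed

lemma convolution_operator_square:
  assumes e: "e \<in> l2_space M"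
  shows "convolution_operator G (group_convolution G N N) e g
    = convolution_operator G N (convolution_operator G N e) g"
proof -
  have [measurable]: "e \<in> borel_measurable borel" by (rule l2_space_measurable[OF e])
  \<comment> \<open>Square-integrability of \<open>e\<close> is relative to Haar measure; the
    bounded density \<open>\<psi>\<close> transfers integrability to the convolution.\<close>
  have "integrable (group_convolution G N N) (\<lambda>x. e (g \<otimes> x))"
    unfolding NN_density using integrable_haar_left[of e g] l2_space_integrable[OF e]
    by (intro integrable_density_haar[OF \<psi>_cont \<psi>_nonneg]) auto
  then show ?thesis
    unfolding convolution_operator_def
    by (subst group_convolution_integral[OF prob_N sets_N]) (auto simp: m_assoc)
qed

lemma l2_inner_convolution_operator:
  assumes e: "e \<in> l2_space M"
  shows "l2_inner M (convolution_operator G (group_convolution G N N) e) e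
    = (LINT z|M. l2_inner M (\<lambda>h. complex_of_real (\<phi> (inv h \<otimes> z))) e
        * cnj (l2_inner M (\<lambda>h. complex_of_real (\<phi> (inv z \<otimes> h))) e))"
proof -
  let ?S = "convolution_operator G N e"
  have [measurable]: "e \<in> borel_measurable borel" "\<phi> \<in> borel_measurable borel" "?S \<in> borel_measurable borel"
    using l2_space_measurable[OF e] borel_measurable_continuous_onI[OF \<phi>_cont]
      convolution_operator_measurable[OF \<phi>_cont \<phi>_nonneg e] by (auto simp: N_density)
  obtain C where C: "C > 0" "\<And>h. \<phi> h \<le> C" "cmod (?S z) \<le> C * (LINT h|M. cmod (e h))" for z
    using convolution_operator_bound[OF \<phi>_cont \<phi>_nonneg] e unfolding N_density by metis
  define C' where "C' = C * (C * (LINT h|M. cmod (e h)))"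
  \<comment> \<open>Since \<open>\<phi>\<close> is real, the outer conjugation only removes the one
    on \<open>e\<close>.\<close>
  have S_eq: "?S z = cnj (l2_inner M (\<lambda>h. complex_of_real (\<phi> (inv z \<otimes> h))) e)" for z
    unfolding l2_inner_commute[symmetric]
    by (simp add: N_density convolution_operator_kernel[OF \<phi>_cont \<phi>_nonneg] l2_inner_def mult.commute)
  have [measurable]: "cnj \<in> borel_measurable borel"
    by (rule borel_measurable_continuous_onI[OF continuous_on_cnj[OF continuous_on_id]])
  have e_int: "integrable M e" by (rule l2_space_integrable[OF e])
  interpret pair_prob_space M M ..
  let ?F = "\<lambda>g z. complex_of_real (\<phi> (inv g \<otimes> z)) * ?S z * cnj (e g)"
  have "integrable (M \<Otimes>\<^sub>M M) (\<lambda>(g, z). ?F g z)"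
  proof (rule Bochner_Integration.integrable_bound)
    show "integrable (M \<Otimes>\<^sub>M M) (\<lambda>(g, z). C' * cmod (e g))"
      using e_int by (intro Fubini_integrable) (auto simp: abs_mult)
    have "cmod (?F g z) \<le> \<bar>C' * cmod (e g)\<bar>" for g z
    proof (rule order_trans[OF _ abs_ge_self])
      show "cmod (?F g z) \<le> C' * cmod (e g)"
        using C(2)[of "inv g \<otimes> z"] C(1) C(3)[of z] \<phi>_nonneg unfolding C'_def
        by (auto simp: norm_mult intro!: mult_right_mono mult_mono)
    qed
    then show "AE p in M \<Otimes>\<^sub>M M. norm (case p of (g, z) \<Rightarrow> ?F g z) \<le> norm (case p of (g, z) \<Rightarrow> C' * cmod (e g))"
      by (intro AE_I2) (simp add: split_beta' del: norm_mult)
    show "(\<lambda>(g, z). ?F g z) \<in> borel_measurable (M \<Otimes>\<^sub>M M)" by measurable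
  qed
  then have "(LINT z|M. LINT g|M. ?F g z) = (LINT g|M. LINT z|M. ?F g z)"
    by (rule Fubini_integral)
  moreover have "(LINT g|M. LINT z|M. ?F g z) = l2_inner M (convolution_operator G (group_convolution G N N) e) e"
    unfolding l2_inner_def convolution_operator_square[OF e]
    by (subst (2) N_density, subst convolution_operator_kernel[OF \<phi>_cont \<phi>_nonneg]) auto
  moreover have "(LINT z|M. LINT g|M. ?F g z)
      = (LINT z|M. ?S z * l2_inner M (\<lambda>h. complex_of_real (\<phi> (inv h \<otimes> z))) e)"
    unfolding l2_inner_def by (simp add: mult.assoc mult.left_commute flip: integral_mult_right_zero)
  ultimately show ?thesis by (simp add: S_eq mult.commute)
qed

lemma has_l2_trace_convolution_operator:
  "has_l2_trace M (convolution_operator G (group_convolution G N N)) (complex_of_real (\<psi> \<one>))"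
  unfolding has_l2_trace_def
proof (intro conjI allI impI)
  show "l2_bounded_operator M (convolution_operator G (group_convolution G N N))"
    unfolding NN_density by (rule l2_bounded_convolution_operator[OF \<psi>_cont \<psi>_nonneg])
  fix E assume E: "l2_orthonormal_basis M E"
  let ?P = "\<lambda>z h. complex_of_real (\<phi> (inv h \<otimes> z))" and ?Q = "\<lambda>z h. complex_of_real (\<phi> (inv z \<otimes> h))"
  have [measurable]: "\<phi> \<in> borel_measurable borel" using \<phi>_cont by (rule borel_measurable_continuous_onI)
  have "l2_inner M (?P z) (?Q z) = complex_of_real (\<psi> \<one>)" for z
  proof -
    have "l2_inner M (?P z) (?Q z) = (LINT h|M. complex_of_real (\<phi> (inv h \<otimes> z) * \<phi> (inv z \<otimes> h)))"
      by (simp add: l2_inner_def)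
    also have "\<dots> = complex_of_real (LINT h|M. \<phi> (inv h \<otimes> z) * \<phi> (inv z \<otimes> h))"
      by (rule integral_complex_of_real)
    \<comment> \<open>Translating \<open>h\<close> by \<open>z\<close> removes \<open>z\<close> from
      the integrand, so the integral over \<open>z\<close> is that of a constant.\<close>
    also have "(LINT h|M. \<phi> (inv h \<otimes> z) * \<phi> (inv z \<otimes> h)) = (LINT h|M. \<phi> (inv (z \<otimes> h) \<otimes> z) * \<phi> (inv z \<otimes> (z \<otimes> h)))"
      by (rule integral_haar_left[symmetric]) measurable
    also have "\<dots> = (LINT h|M. \<phi> h * \<phi> (inv h \<otimes> \<one>))"
      by (simp add: inv_mult_group m_assoc mult.commute)
    also have "\<dots> = \<psi> \<one>" by (rule convolution_density_eq[symmetric])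
    finally show ?thesis .
  qed
  moreover have "((\<lambda>e. LINT z|M. l2_inner M (?P z) e * cnj (l2_inner M (?Q z) e)) has_sum
      (LINT z|M. l2_inner M (?P z) (?Q z))) E"
  proof (rule l2_kernel_trace[OF prob_haar sets_haar compact_UNIV _ _ E])
    show "continuous_on UNIV (\<lambda>(z, h). ?P z h)" "continuous_on UNIV (\<lambda>(z, h). ?Q z h)"
      unfolding split_beta' by (intro continuous_intros continuous_on_compose2[OF \<phi>_cont]; simp)+
  qed
  ultimately have "((\<lambda>e. LINT z|M. l2_inner M (?P z) e * cnj (l2_inner M (?Q z) e)) has_sum
      complex_of_real (\<psi> \<one>)) E" by simp
  then show "((\<lambda>e. l2_inner M (convolution_operator G (group_convolution G N N) e) e) has_sum
      complex_of_real (\<psi> \<one>)) E"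
    using l2_inner_convolution_operator l2_orthonormal_basisD(2)[OF E] by (subst has_sum_cong) auto
qed

end

end

section \<open>Transition densities on homogeneous spaces\<close>

text \<open>Continuity is recorded for each \<open>act g\<close> and for the orbit map at
  \<open>x0\<close>, the two properties of the action on which the descent to the quotient
  rests.\<close>

locale compact_homogeneous_space = compact_haar_group G M
  for G :: "'g::{t2_space, second_countable_topology} monoid" (structure) and M :: "'g measure" +
  fixes act :: "'g \<Rightarrow> 'x::t2_space \<Rightarrow> 'x" and x0 :: 'x
  assumes act_mult: "act (g \<otimes> h) x = act g (act h x)"
    and act_one: "act \<one> x = x"
    and act_transitive: "\<exists>g. act g x0 = x"
    and continuous_act: "continuous_on UNIV (act g)"
    and continuous_orbit: "continuous_on UNIV (\<lambda>g. act g x0)"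
begin

lemma act_inv [simp]: "act g (act (inv g) x) = x" "act (inv g) (act g x) = x"
  by (simp_all add: act_one flip: act_mult)

lemma orbit_measurable [measurable]: "(\<lambda>g. act g x0) \<in> borel_measurable borel"
  by (rule borel_measurable_continuous_onI[OF continuous_orbit])

lemma inv_stabilizer: "k \<in> stabilizer G act x0 \<Longrightarrow> inv k \<in> stabilizer G act x0"
  using act_inv(2)[of k x0] by (simp add: stabilizer_def)

text \<open>The orbit map is closed, being continuous from a compact space to a Hausdorff one. So
  the preimage of a closed set under the descended function, which is the image of a compact set, is
  closed.\<close>

lemma right_invariant_descends:
  fixes D :: "'g \<Rightarrow> real"
  assumes D: "continuous_on UNIV D" and inv: "\<And>g k. k \<in> stabilizer G act x0 \<Longrightarrow> D (g \<otimes> k) = D g"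
  obtains F where "continuous_on UNIV F" "\<And>g. D g = F (act g x0)"
proof -
  have D_eq: "D g = D h" if "act g x0 = act h x0" for g h
  proof -
    have "act (inv g \<otimes> h) x0 = x0" by (simp add: act_mult flip: that)
    then have "D (g \<otimes> (inv g \<otimes> h)) = D g" by (intro inv) (simp add: stabilizer_def)
    then show ?thesis by simp
  qed
  define F where "F x = D (SOME g. act g x0 = x)" for x
  have F: "D g = F (act g x0)" for g
    unfolding F_def by (rule D_eq, rule sym, rule someI[of "\<lambda>h. act h x0 = act g x0"]) (rule refl)
  have "closed (F -` C)" if "closed C" for C
  proof -
    have "F -` C = (\<lambda>g. act g x0) ` (D -` C)"
    proof (intro equalityI subsetI)
      fix x assume x: "x \<in> F -` C"
      obtain g where "act g x0 = x" using act_transitive by blast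
      then show "x \<in> (\<lambda>g. act g x0) ` (D -` C)" using x F by auto
    qed (auto simp: F)
    moreover have "compact (D -` C)"
      using compact_Int_closed[OF compact_UNIV] D that by (simp add: continuous_on_closed_vimage)
    ultimately have "compact (F -` C)"
      using compact_continuous_image[OF continuous_on_subset[OF continuous_orbit subset_UNIV]] by simp
    then show ?thesis by (rule compact_imp_closed)
  qed
  then have "continuous_on UNIV F" by (simp add: continuous_on_closed_vimage)
  then show thesis using that F by blast
qed

section \<open>Lifting a transition density from the quotient to the group\<close>

context
  fixes N :: "'g measure" and \<kappa> :: "'x \<Rightarrow> 'x \<Rightarrow> real"
  assumes N: "prob_space N" "sets N = sets borel"
    and N_right: "\<And>k. k \<in> stabilizer G act x0 \<Longrightarrow> distr N borel (\<lambda>g. g \<otimes> k) = N"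
    and trans: "is_transition_density G M act x0 N \<kappa>"
begin

lemma continuous_kernel: "continuous_on UNIV (\<lambda>h. \<kappa> x (act h x0))"
proof -
  have "continuous_on UNIV (\<lambda>(x, y). \<kappa> x y)" using trans by (simp add: is_transition_density_def)
  from continuous_on_compose2[OF continuous_on_curried(1)[OF this] continuous_orbit]
  show ?thesis by simp
qed

lemma kernel_nonneg: "0 \<le> \<kappa> x y"
  using trans by (simp add: is_transition_density_def)

lemma transition_integral:
  fixes f :: "'x \<Rightarrow> real"
  assumes f: "continuous_on UNIV f"
  shows "(LINT h|M. \<kappa> (act g x0) (act h x0) * f (act h x0)) = (LINT h|N. f (act (g \<otimes> h) x0))"
proof -
  have "continuous_on UNIV (\<lambda>(x, y). \<kappa> x y)" using trans by (simp add: is_transition_density_def)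
  from continuous_on_mult[OF f continuous_on_curried(1)[OF this]]
  have "(\<lambda>y. f y * \<kappa> (act g x0) y) \<in> borel_measurable borel"
    by (rule borel_measurable_continuous_onI)
  moreover have "(\<lambda>h. act h x0) \<in> M \<rightarrow>\<^sub>M borel" by measurable
  ultimately have "(LINT y|distr M borel (\<lambda>h. act h x0). f y * \<kappa> (act g x0) y)
      = (LINT h|M. f (act h x0) * \<kappa> (act g x0) (act h x0))"
    by (intro integral_distr)
  then show ?thesis using trans f by (simp add: is_transition_density_def mult.commute)
qed

text \<open>For continuous \<open>u\<close> the function \<open>g \<mapsto> \<integral>u(g h\<^sup>-\<^sup>1) \<nu>(dh)\<close> is right invariant under the stabiliser
  whenever \<open>\<nu>\<close> is, so it comes from a function on the quotient. Hence \<open>\<nu>\<close> is determined by its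
  image on the quotient, without averaging over a Haar measure of the stabiliser.\<close>

lemma transition_density_measure:
  "N = density M (\<lambda>h. ennreal (\<kappa> x0 (act h x0)))"
proof -
  define \<psi> where "\<psi> h = \<kappa> x0 (act h x0)" for h
  define N' where "N' = density M (\<lambda>h. ennreal (\<psi> h))"
  have \<psi>: "continuous_on UNIV \<psi>" "0 \<le> \<psi> h" for h
    unfolding \<psi>_def by (intro continuous_kernel kernel_nonneg)+
  have [measurable]: "\<psi> \<in> borel_measurable borel" by (rule borel_measurable_continuous_onI[OF \<psi>(1)])
  interpret N: prob_space N by (rule N)
  have N'_sets: "sets N' = sets borel" unfolding N'_def by (simp add: sets_haar)
  have int_N': "(LINT h|N'. u h) = (LINT h|M. \<psi> h * u h)" if "u \<in> borel_measurable borel" for u :: "'g \<Rightarrow> real"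
    unfolding N'_def using integral_density_haar[OF \<psi> that] by simp
  \<comment> \<open>The kernel at the base point describes the image of \<open>N\<close> on the
    quotient; hence \<open>N\<close> and \<open>N'\<close> have the same image.\<close>
  have same: "(LINT h|N. f (act h x0)) = (LINT h|N'. f (act h x0))" if f: "continuous_on UNIV f" for f :: "'x \<Rightarrow> real"
  proof -
    have "continuous_on UNIV (\<lambda>h. f (act h x0))"
      by (rule continuous_on_compose2[OF f continuous_orbit]) simp
    then have "(LINT h|N'. f (act h x0)) = (LINT h|M. \<psi> h * f (act h x0))"
      by (intro int_N' borel_measurable_continuous_onI)
    then show ?thesis using transition_integral[OF f, of \<one>] by (simp add: \<psi>_def act_one)
  qed
  have N': "prob_space N'"
  proof
    have "(LINT h|M. \<psi> h) = 1"
      using same[of "\<lambda>_. 1"] int_N'[of "\<lambda>_. 1"] N.prob_space by simp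
    then have "(\<integral>\<^sup>+h. ennreal (\<psi> h) \<partial>M) = 1"
      using integrable_continuous[OF \<psi>(1)] \<psi>(2) by (simp add: nn_integral_eq_integral)
    then show "emeasure N' (space N') = 1"
      unfolding N'_def by (simp add: emeasure_density)
  qed
  have right: "(LINT h|N. u (h \<otimes> k)) = (LINT h|N. u h)" "(LINT h|N'. u (h \<otimes> k)) = (LINT h|N'. u h)"
    if k: "k \<in> stabilizer G act x0" and u: "continuous_on UNIV u" for u :: "'g \<Rightarrow> real" and k
  proof -
    have [measurable]: "u \<in> borel_measurable borel" by (rule borel_measurable_continuous_onI[OF u])
    have [measurable_cong]: "sets N = sets borel" by (rule N)
    show "(LINT h|N. u (h \<otimes> k)) = (LINT h|N. u h)"
      by (subst (2) N_right[OF k, symmetric], subst integral_distr) auto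
    have "\<psi> (h \<otimes> k) = \<psi> h" for h
      using k by (simp add: \<psi>_def act_mult stabilizer_def)
    then show "(LINT h|N'. u (h \<otimes> k)) = (LINT h|N'. u h)"
      using integral_haar_right[of "\<lambda>h. \<psi> h * u h" k] by (simp add: int_N')
  qed
  have "N = N'"
  proof (rule borel_prob_eqI_continuous[OF compact_UNIV N N' N'_sets])
    fix w :: "'g \<Rightarrow> real" assume w: "continuous_on UNIV w"
    \<comment> \<open>The inversion is chosen so that \<open>D \<nu> \<one>\<close> below is the
      integral of \<open>w\<close> against \<open>\<nu>\<close>.\<close>
    define u where "u g = w (inv g)" for g
    have u: "continuous_on UNIV u"
      unfolding u_def by (intro continuous_on_compose2[OF w] continuous_intros) auto
    obtain B where B: "\<And>x. norm (u x) \<le> B"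
      using compact_UNIV_norm_bound[OF compact_UNIV u] by blast
    have u': "continuous_on S (\<lambda>x. u (f x))" if "continuous_on S f" for S and f :: "'z::topological_space \<Rightarrow> 'g"
      by (rule continuous_on_compose2[OF u that]) simp
    define D where "D \<nu> g = (LINT h|\<nu>. u (g \<otimes> inv h))" for \<nu> g
    have D_cont: "continuous_on UNIV (D \<nu>)" if \<nu>: "prob_space \<nu>" "sets \<nu> = sets borel" for \<nu>
    proof -
      interpret \<nu>: prob_space \<nu> by fact
      have [measurable_cong]: "sets \<nu> = sets borel" by fact
      show ?thesis unfolding D_def
      proof (rule continuous_on_integral_dominated[where w = "\<lambda>_. B"])
        have "(\<lambda>h. u (g \<otimes> inv h)) \<in> borel_measurable borel" for g
          by (intro borel_measurable_continuous_onI u' continuous_intros)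
        then show "(\<lambda>h. u (g \<otimes> inv h)) \<in> borel_measurable \<nu>" for g by simp
      qed (auto intro!: B[unfolded real_norm_def] u' continuous_intros)
    qed
    \<comment> \<open>\<open>g \<otimes> k \<otimes> inv h\<close> is
      \<open>g \<otimes> inv (h \<otimes> inv k)\<close>, so right invariance is needed for
      \<open>inv k\<close>.\<close>
    have D_inv: "D \<nu> (g \<otimes> k) = D \<nu> g" if "\<nu> \<in> {N, N'}" "k \<in> stabilizer G act x0" for \<nu> g k
    proof -
      have "continuous_on UNIV (\<lambda>h. u (g \<otimes> inv h))" by (intro u' continuous_intros)
      from right[OF inv_stabilizer[OF that(2)] this]
      show ?thesis using that(1) unfolding D_def by (auto simp: inv_mult_group m_assoc)
    qed
    \<comment> \<open>Right invariance of Haar measure moves \<open>\<nu>\<close> from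
      \<open>u\<close> onto \<open>f\<close>. Against functions on the quotient,
      \<open>D \<nu>\<close> therefore sees only the image of \<open>\<nu>\<close> there.\<close>
    have D_int: "(LINT g|M. f (act g x0) * D \<nu> g) = (LINT g|M. u g * (LINT h|\<nu>. f (act g (act h x0))))"
      if \<nu>: "prob_space \<nu>" "sets \<nu> = sets borel" and f: "continuous_on UNIV f" for \<nu> and f :: "'x \<Rightarrow> real"
    proof -
      have f': "continuous_on UNIV (\<lambda>g. f (act g x0))"
        by (rule continuous_on_compose2[OF f continuous_orbit]) simp
      then have f'': "continuous_on S (\<lambda>x. f (act (v x) x0))"
        if "continuous_on S v" for S and v :: "'z::topological_space \<Rightarrow> 'g"
        using continuous_on_compose2[OF f' that] by simp
      have "(LINT g|M. f (act g x0) * D \<nu> g) = (LINT g|M. LINT h|\<nu>. f (act g x0) * u (g \<otimes> inv h))"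
        unfolding D_def by simp
      also have "\<dots> = (LINT h|\<nu>. LINT g|M. f (act g x0) * u (g \<otimes> inv h))"
        by (rule fubini_continuous[OF prob_haar sets_haar \<nu>, symmetric])
          (unfold split_beta', intro u' f'' continuous_intros)
      also have "\<dots> = (LINT h|\<nu>. LINT g|M. u g * f (act (g \<otimes> h) x0))"
      proof (rule Bochner_Integration.integral_cong[OF refl])
        fix h
        have "(\<lambda>g. f (act g x0) * u (g \<otimes> inv h)) \<in> borel_measurable borel"
          by (intro borel_measurable_continuous_onI u' f'' continuous_intros)
        from integral_haar_right[OF this, of h]
        show "(LINT g|M. f (act g x0) * u (g \<otimes> inv h)) = (LINT g|M. u g * f (act (g \<otimes> h) x0))"
          by (simp add: m_assoc mult.commute)
      qed
      also have "\<dots> = (LINT g|M. LINT h|\<nu>. u g * f (act (g \<otimes> h) x0))"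
        by (rule fubini_continuous[OF prob_haar sets_haar \<nu>])
          (unfold split_beta', intro u' f'' continuous_intros)
      finally show ?thesis by (simp add: act_mult)
    qed
    \<comment> \<open>The difference descends to the quotient, so it is an admissible test function
      against itself.\<close>
    have "continuous_on UNIV (\<lambda>g. D N g - D N' g)"
      by (intro continuous_intros D_cont N N' N'_sets)
    then obtain F where F: "continuous_on UNIV F" "\<And>g. D N g - D N' g = F (act g x0)"
      by (rule right_invariant_descends) (simp_all add: D_inv)
    have "(LINT h|N. F (act g (act h x0))) = (LINT h|N'. F (act g (act h x0)))" for g
      using same[of "\<lambda>x. F (act g x)"] continuous_on_compose2[OF F(1) continuous_act[of g]] by simp
    then have "(LINT g|M. F (act g x0) * D N g) = (LINT g|M. F (act g x0) * D N' g)"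
      using D_int[OF N F(1)] D_int[OF N' N'_sets F(1)] by simp
    then have "D N \<one> = D N' \<one>"
      by (intro continuous_eqI_haar[OF D_cont[OF N] D_cont[OF N' N'_sets]]) (simp add: F(2))
    then show "(LINT x|N. w x) = (LINT x|N'. w x)"
      by (simp add: D_def u_def)
  qed
  then show ?thesis unfolding N'_def \<psi>_def .
qed

text \<open>As functions of \<open>h\<close> both sides are continuous densities of one and the same
  image measure, that of \<open>N\<close> translated by \<open>g\<close>. Their difference is a
  function of \<open>act h x0\<close>, so it may serve as the test function in
  \<open>transition_integral\<close>.\<close>

lemma kernel_invariant: "\<kappa> (act g x0) (act h x0) = \<kappa> x0 (act (inv g \<otimes> h) x0)"
proof (rule continuous_eqI_haar[where f = "\<lambda>h. \<kappa> (act g x0) (act h x0)"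
      and f' = "\<lambda>h. \<kappa> x0 (act (inv g \<otimes> h) x0)"])
  let ?f = "\<lambda>y. \<kappa> (act g x0) y - \<kappa> x0 (act (inv g) y)"
  have \<kappa>: "continuous_on UNIV (\<lambda>(x, y). \<kappa> x y)" using trans by (simp add: is_transition_density_def)
  show "continuous_on UNIV (\<lambda>h. \<kappa> (act g x0) (act h x0))" by (rule continuous_kernel)
  show 2: "continuous_on UNIV (\<lambda>h. \<kappa> x0 (act (inv g \<otimes> h) x0))"
    by (rule continuous_on_compose2[OF continuous_kernel]) (auto intro: continuous_intros)
  have f: "continuous_on UNIV ?f"
    using continuous_on_compose2[OF continuous_on_curried(1)[OF \<kappa>] continuous_act]
    by (intro continuous_intros continuous_on_curried(1)[OF \<kappa>]) auto
  have f': "continuous_on UNIV (\<lambda>h. ?f (act h x0))"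
    by (rule continuous_on_compose2[OF f continuous_orbit]) simp
  have f'': "continuous_on UNIV (\<lambda>h. ?f (act (g \<otimes> h) x0))"
    by (rule continuous_on_compose2[OF f'], intro continuous_intros) auto
  have "(LINT h|M. \<kappa> (act g x0) (act h x0) * ?f (act h x0)) = (LINT h|N. ?f (act (g \<otimes> h) x0))"
    by (rule transition_integral[OF f])
  also have "\<dots> = (LINT h|M. \<kappa> x0 (act h x0) * ?f (act (g \<otimes> h) x0))"
    by (subst transition_density_measure, subst integral_density_haar[OF continuous_kernel kernel_nonneg])
      (use borel_measurable_continuous_onI[OF f''] in simp_all)
  also have "\<dots> = (LINT h|M. \<kappa> x0 (act (inv g \<otimes> (g \<otimes> h)) x0) * ?f (act (g \<otimes> h) x0))"
    by simp
  also have "\<dots> = (LINT h|M. \<kappa> x0 (act (inv g \<otimes> h) x0) * ?f (act h x0))"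
    by (rule integral_haar_left[where f = "\<lambda>h. \<kappa> x0 (act (inv g \<otimes> h) x0) * ?f (act h x0)"])
      (intro borel_measurable_continuous_onI continuous_on_mult 2 f')
  finally show "(LINT h|M. (\<kappa> (act g x0) (act h x0) - \<kappa> x0 (act (inv g \<otimes> h) x0)) * \<kappa> (act g x0) (act h x0))
      = (LINT h|M. (\<kappa> (act g x0) (act h x0) - \<kappa> x0 (act (inv g \<otimes> h) x0)) * \<kappa> x0 (act (inv g \<otimes> h) x0))"
    by (simp add: act_mult mult.commute)
qed

lemma kernel_diagonal: "\<kappa> x x = \<kappa> x0 x0"
proof -
  obtain g where "act g x0 = x" using act_transitive by blast
  then show ?thesis using kernel_invariant[of g g] by (simp add: act_one)
qed

end

text \<open>Here \<open>N\<close> stands for the law at half the time. Its kernel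
  \<open>\<kappa>\<close> supplies the continuous square root, while \<open>\<kappa>'\<close> is the
  kernel whose diagonal value is the trace.\<close>

theorem has_l2_trace_transition_kernel:
  assumes N: "prob_space N" "sets N = sets borel"
    and N_right: "\<And>k. k \<in> stabilizer G act x0 \<Longrightarrow> distr N borel (\<lambda>g. g \<otimes> k) = N"
    and \<kappa>: "is_transition_density G M act x0 N \<kappa>"
    and NN_right: "\<And>k. k \<in> stabilizer G act x0 \<Longrightarrow>
      distr (group_convolution G N N) borel (\<lambda>g. g \<otimes> k) = group_convolution G N N"
    and \<kappa>': "is_transition_density G M act x0 (group_convolution G N N) \<kappa>'"
  shows "\<kappa>' x x = \<kappa>' x0 x0"
    "has_l2_trace M (convolution_operator G (group_convolution G N N)) (complex_of_real (\<kappa>' x0 x0))"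
proof -
  interpret N: prob_space N by fact
  interpret N2: pair_prob_space N N ..
  have NN: "prob_space (group_convolution G N N)" "sets (group_convolution G N N) = sets borel"
  proof -
    have [measurable_cong]: "sets N = sets borel" by fact
    show "prob_space (group_convolution G N N)"
      unfolding group_convolution_def by (rule N2.prob_space_distr) measurable
  qed (simp add: group_convolution_def)
  show "\<kappa>' x x = \<kappa>' x0 x0" by (rule kernel_diagonal[OF NN NN_right \<kappa>'])
  show "has_l2_trace M (convolution_operator G (group_convolution G N N)) (complex_of_real (\<kappa>' x0 x0))"
    using has_l2_trace_convolution_operator[OF continuous_kernel[OF N N_right \<kappa>] kernel_nonneg[OF N N_right \<kappa>]
        continuous_kernel[OF NN NN_right \<kappa>'] kernel_nonneg[OF NN NN_right \<kappa>'] N(1)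
        transition_density_measure[OF N N_right \<kappa>] transition_density_measure[OF NN NN_right \<kappa>']]
    by (simp add: act_one)
qed

end

section \<open>From the symmetric space to the homogeneous space\<close>

lemma (in compact_irreducible_symmetric_space) compact_homogeneous_space:
  assumes "normalised_haar G M"
  shows "compact_homogeneous_space G M act x0"
proof
  have act: "continuous_map euclidean isometry_topology act"
    using homeomorphic_imp_continuous_map[OF act_homeomorphic] by (simp add: continuous_map_in_subtopology)
  have isom: "isometry (act g)" for g
    using act unfolding isometry_topology_def by (auto simp: continuous_map_in_subtopology)
  then show cont: "continuous_on UNIV (act g)" for g
    by (simp add: isometry_def smooth_map_def)
  show "continuous_on UNIV (\<lambda>g. act g x0)"
    unfolding continuous_on_open_vimage[OF open_UNIV]
  proof (intro allI impI)
    fix U :: "'x set" assume "open U"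
    let ?\<B> = "{{f. continuous_on UNIV f \<and> f ` C \<subseteq> U} | C U. compact C \<and> open (U :: 'x set)}"
    \<comment> \<open>A singleton is compact, so evaluation at \<open>x0\<close> is continuous for
      the compact-open topology; composed with \<open>act\<close> it is the orbit map.\<close>
    have "{f. continuous_on UNIV f \<and> f ` {x0} \<subseteq> U} \<in> ?\<B>"
      by (intro CollectI exI[of _ "{x0}"] exI[of _ U]) (simp add: \<open>open U\<close>)
    then have "openin (topology_generated_by ?\<B>) {f. continuous_on UNIV f \<and> f ` {x0} \<subseteq> U}"
      by (rule topology_generated_by_Basis)
    moreover have "continuous_map euclidean (topology_generated_by ?\<B>) act"
      using act unfolding isometry_topology_def by (simp add: continuous_map_in_subtopology)
    ultimately have "openin euclidean {g \<in> topspace euclidean. act g \<in> {f. continuous_on UNIV f \<and> f ` {x0} \<subseteq> U}}"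
      by (rule openin_continuous_map_preimage[rotated])
    then show "open ((\<lambda>g. act g x0) -` U \<inter> UNIV)" using cont by (simp add: vimage_def)
  qed
  show "act \<one> x = x" for x using id_eq_one by (metis UNIV_I restrict_apply')
  show "act (g \<otimes> h) x = act g (act h x)" for g h x
    by (rule composition_rule) (simp_all add: carrier_UNIV)
  show "\<exists>g. act g x0 = x" for x using unique_orbit[of x0 x] by blast
  show "continuous_on UNIV (\<lambda>(g, h). g \<otimes> h)" "continuous_on UNIV (\<lambda>g. inv g)"
    using smooth_mult smooth_inv by (simp_all add: smooth_map_def)
qed (use carrier_UNIV compact_group assms in auto)

theorem corollary5p3:
  fixes G :: "'g::{t2_space,second_countable_topology} monoid"
    and B :: "('g, 'a::euclidean_space) chart set"
    and A :: "('x::{t2_space,second_countable_topology}, 'e::euclidean_space) chart set"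
    and met :: "('x, 'e) chart \<Rightarrow> 'x \<Rightarrow> 'e \<Rightarrow> 'e \<Rightarrow> real"
    and act :: "'g \<Rightarrow> 'x \<Rightarrow> 'x"
    and x0 :: 'x
    and haar :: "'g measure"
    and \<mu> :: "real \<Rightarrow> 'g measure"
    and k :: "real \<Rightarrow> 'x \<Rightarrow> 'x \<Rightarrow> real"
  assumes "compact_irreducible_symmetric_space G B A met act x0"
    and "normalised_haar G haar"
    and "convolution_semigroup G \<mu>"
    and "\<And>t. t \<ge> 0 \<Longrightarrow> bi_invariant G (stabilizer G act x0) (\<mu> t)"
    and "\<And>t. t > 0 \<Longrightarrow> has_square_integrable_density haar (\<mu> t)"
    and "\<And>t. t > 0 \<Longrightarrow> is_transition_density G haar act x0 (\<mu> t) (k t)"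
  shows "\<forall>t>0. \<forall>x. k t x x = k t x0 x0 \<and>
           has_l2_trace haar (convolution_operator G (\<mu> t)) (complex_of_real (k t x0 x0))"
proof (intro allI impI)
  fix t :: real and x :: 'x
  assume t: "0 < t"
  interpret compact_homogeneous_space G haar act x0
    using compact_irreducible_symmetric_space.compact_homogeneous_space[OF assms(1,2)] .
  have prob: "prob_space (\<mu> (t/2))" "sets (\<mu> (t/2)) = sets borel"
    and square: "group_convolution G (\<mu> (t/2)) (\<mu> (t/2)) = \<mu> t"
  proof -
    have "\<forall>s\<ge>0. \<forall>r\<ge>0. \<mu> (s + r) = group_convolution G (\<mu> s) (\<mu> r)"
      using assms(3) by (simp add: convolution_semigroup_def)
    from this[rule_format, of "t/2" "t/2"] t
    show "group_convolution G (\<mu> (t/2)) (\<mu> (t/2)) = \<mu> t" by simp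
  qed (use assms(3) t in \<open>simp_all add: convolution_semigroup_def\<close>)
  have right: "distr (\<mu> s) borel (\<lambda>g. g \<otimes>\<^bsub>G\<^esub> h) = \<mu> s" if "s > 0" "h \<in> stabilizer G act x0" for s h
    using assms(4)[of s] that by (simp add: bi_invariant_def)
  show "k t x x = k t x0 x0 \<and>
      has_l2_trace haar (convolution_operator G (\<mu> t)) (complex_of_real (k t x0 x0))"
    \<comment> \<open>Exhibiting \<open>\<mu> t\<close> as a convolution square is what the trace
      theorem asks for; \<open>k (t/2)\<close> provides the continuous density of the root.\<close>
    unfolding square[symmetric]
    using t by (intro conjI has_l2_trace_transition_kernel[OF prob, of "k (t/2)" "k t"])
      (simp_all add: square right assms(6))
qed

end
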